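(* Let $H$ be a real Hilbert space with a compatible triple $(g,J,\omega)$. The Siegel disk $\mathfrak{D}(H)$ is an open subset of the Banach space of bounded linear operators $Z:L^+\to L^-$ satisfying $\alpha Z\alpha=Z^*$, and in particular is a complex Banach manifold. The restricted Siegel disk $\mathfrak{D}_2(H)$ is an open subset of the Hilbert space of Hilbert–Schmidt operators $Z:L^+\to L^-$ satisfying $\alpha Z\alpha=Z^*$, and in particular is a complex Hilbert manifold.
   Context: Hilbert spaces are separable, possibly finite-dimensional. A compatible triple $(g,J,\omega)$ on a real Hilbert space $H$ consists of: a strong inner product $g$ (continuous symmetric bilinear form, $g(v,v)\ge0$, such that $v\mapsto g(v,\cdot)$ is a bounded isomorphism $H\to H^*$); a complex structure $J$ (continuous linear, $J^2=-\mathrm{id}$); and a strong symplectic form $\omega$ (continuous anti-symmetric bilinear form such that $v\mapsto\omega(v,\cdot)$ is a bounded isomorphism $H\to H^*$), with $g(v,w)=\omega(v,Jw)$. $H_{\mathbb{C}}=H\otimes_{\mathbb{R}}\mathbb{C}$, and $\alpha:H_{\mathbb{C}}\to H_{\mathbb{C}}$ is the conjugate-linear involution extending $v\otimes\lambda\mapsto v\otimes\overline\lambda$. $J$ is extended complex-linearly and $g$ sesquilinearly (linear in the first entry) to $H_{\mathbb{C}}$. $L^{\pm}=\ker(J\mp i)\subset H_{\mathbb{C}}$; then $H_{\mathbb{C}}=L^+\oplus L^-$ is orthogonal for $g$ and $\alpha(L^+)=L^-$. Adjoints and norms are taken with respect to $g$. $\mathfrak{D}(H)=\{Z\in\mathcal{B}(L^+,L^-)\mid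 Z=\alpha Z^*\alpha \text{ and } \mathbf{1}-Z^*Z>0\}$, where $\mathcal{B}(L^+,L^-)$ is the space of bounded complex-linear operators and $T>0$ for a self-adjoint operator $T$ on $L^+$ means that there is $c>0$ with $g(x,Tx)\ge c\,g(x,x)$ for all $x\in L^+$. $\mathfrak{D}_2(H)=\mathfrak{D}(H)\cap\mathcal{B}_2(L^+,L^-)$, where $\mathcal{B}_2(L^+,L^-)$ is the Hilbert space of Hilbert–Schmidt operators, with the Hilbert–Schmidt norm. *)

theory Defs
  imports "HOL-Analysis.Analysis" "HOL-Library.Function_Algebras"
begin

section \<open>Complex vector spaces\<close>

class complex_vector = ab_group_add +
  fixes scaleC :: "complex \<Rightarrow> 'a \<Rightarrow> 'a"  (infixr \<open>*\<^sub>C\<close> 75)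
  assumes scaleC_add_right: "a *\<^sub>C (x + y) = a *\<^sub>C x + a *\<^sub>C y"
    and scaleC_add_left: "(a + b) *\<^sub>C x = a *\<^sub>C x + b *\<^sub>C x"
    and scaleC_scaleC: "a *\<^sub>C (b *\<^sub>C x) = (a * b) *\<^sub>C x"
    and scaleC_one: "1 *\<^sub>C x = x"

global_interpretation complex_vector: vector_space "scaleC :: complex \<Rightarrow> 'a \<Rightarrow> 'a :: complex_vector"
  by unfold_locales (simp_all add: scaleC_add_right scaleC_add_left scaleC_scaleC scaleC_one)

instantiation "fun" :: (type, complex_vector) complex_vector
begin
definition scaleC_fun_def: "c *\<^sub>C f = (\<lambda>x. c *\<^sub>C f x)"
instance
  by standard (simp_all add: scaleC_fun_def fun_eq_iff scaleC_add_right scaleC_add_left scaleC_scaleC scaleC_one)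
end


section \<open>Normed, Banach and Hilbert spaces on explicit carriers\<close>

text \<open>
  The operator spaces below depend on \<open>J\<close> and \<open>g\<close>, hence are given by a carrier \<open>V\<close> inside an
  ambient complex vector space together with a norm \<open>N\<close> (or inner product) that is only
  meaningful on \<open>V\<close>. The case distinction in \<open>norm_dist\<close> is there because the locale
  \<^locale>\<open>Metric_space\<close> asks for nonnegativity and symmetry of the distance also outside the carrier.
\<close>

definition norm_dist :: "'v::ab_group_add set \<Rightarrow> ('v \<Rightarrow> real) \<Rightarrow> 'v \<Rightarrow> 'v \<Rightarrow> real" where
  "norm_dist V N x y = (if x \<in> V \<and> y \<in> V then N (x - y) else 0)"

definition norm_topology :: "'v::ab_group_add set \<Rightarrow> ('v \<Rightarrow> real) \<Rightarrow> 'v topology" where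
  "norm_topology V N = Metric_space.mtopology V (norm_dist V N)"

definition complex_normed_space :: "'v::complex_vector set \<Rightarrow> ('v \<Rightarrow> real) \<Rightarrow> bool" where
  "complex_normed_space V N \<longleftrightarrow>
     complex_vector.subspace V \<and>
     (\<forall>x\<in>V. 0 \<le> N x) \<and>
     (\<forall>x\<in>V. N x = 0 \<longleftrightarrow> x = 0) \<and>
     (\<forall>c. \<forall>x\<in>V. N (c *\<^sub>C x) = cmod c * N x) \<and>
     (\<forall>x\<in>V. \<forall>y\<in>V. N (x + y) \<le> N x + N y)"

definition complex_banach_space :: "'v::complex_vector set \<Rightarrow> ('v \<Rightarrow> real) \<Rightarrow> bool" where
  "complex_banach_space V N \<longleftrightarrow>
     complex_normed_space V N \<and> Metric_space.mcomplete V (norm_dist V N)"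

definition ip_norm :: "('v \<Rightarrow> 'v \<Rightarrow> complex) \<Rightarrow> 'v \<Rightarrow> real" where
  "ip_norm ip x = sqrt (Re (ip x x))"

text \<open>Inner products are linear in the first entry; Hilbert spaces are separable by convention.\<close>

definition complex_hilbert_space :: "'v::complex_vector set \<Rightarrow> ('v \<Rightarrow> 'v \<Rightarrow> complex) \<Rightarrow> bool" where
  "complex_hilbert_space V ip \<longleftrightarrow>
     complex_vector.subspace V \<and>
     (\<forall>x\<in>V. \<forall>y\<in>V. \<forall>z\<in>V. ip (x + y) z = ip x z + ip y z) \<and>
     (\<forall>c. \<forall>x\<in>V. \<forall>y\<in>V. ip (c *\<^sub>C x) y = c * ip x y) \<and>
     (\<forall>x\<in>V. \<forall>y\<in>V. ip y x = cnj (ip x y)) \<and>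
     (\<forall>x\<in>V. x \<noteq> 0 \<longrightarrow> 0 < Re (ip x x)) \<and>
     Metric_space.mcomplete V (norm_dist V (ip_norm ip)) \<and>
     separable_space (norm_topology V (ip_norm ip))"


section \<open>Bounded operators\<close>

text \<open>
  A complex-linear operator \<open>V \<rightarrow> W\<close> is represented by the function that agrees with it on \<open>V\<close> and
  vanishes outside \<open>V\<close>, so that equality, sums and complex multiples of operators are the pointwise ones.
\<close>

definition bounded_ops ::
  "'v::complex_vector set \<Rightarrow> ('v \<Rightarrow> real) \<Rightarrow> 'w::complex_vector set \<Rightarrow> ('w \<Rightarrow> real) \<Rightarrow> ('v \<Rightarrow> 'w) set" where
  "bounded_ops V N W M =
     {T. T ` V \<subseteq> W \<and> (\<forall>x. x \<notin> V \<longrightarrow> T x = 0) \<and>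
         (\<forall>x\<in>V. \<forall>y\<in>V. T (x + y) = T x + T y) \<and>
         (\<forall>c. \<forall>x\<in>V. T (c *\<^sub>C x) = c *\<^sub>C T x) \<and>
         (\<exists>K. \<forall>x\<in>V. M (T x) \<le> K * N x)}"

definition op_norm :: "'v set \<Rightarrow> ('v \<Rightarrow> real) \<Rightarrow> ('w \<Rightarrow> real) \<Rightarrow> ('v \<Rightarrow> 'w) \<Rightarrow> real" where
  "op_norm V N M T = (SUP x\<in>{x \<in> V. N x \<le> 1}. M (T x))"


section \<open>Complex Banach and Hilbert manifolds\<close>

text \<open>Holomorphic means complex Frechet differentiable at every point; \<open>U\<close> is meant to be open in \<open>V\<close>.\<close>

definition holomorphic_map_on ::
  "'v::complex_vector set \<Rightarrow> ('v \<Rightarrow> real) \<Rightarrow> 'w::complex_vector set \<Rightarrow> ('w \<Rightarrow> real) \<Rightarrow> 'v set \<Rightarrow> ('v \<Rightarrow> 'w) \<Rightarrow> bool" where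
  "holomorphic_map_on V N W M U f \<longleftrightarrow>
     f ` U \<subseteq> W \<and>
     (\<forall>x\<in>U. \<exists>T\<in>bounded_ops V N W M.
        \<forall>\<epsilon>>0. \<exists>\<delta>>0. \<forall>y\<in>U. N (y - x) < \<delta> \<longrightarrow> M (f y - f x - T (y - x)) \<le> \<epsilon> * N (y - x))"

text \<open>A topological space \<open>X\<close> with a holomorphic atlas \<open>A\<close> modelled on the Banach space \<open>(V, N)\<close>.\<close>

definition complex_banach_manifold ::
  "'p topology \<Rightarrow> ('p set \<times> ('p \<Rightarrow> 'v::complex_vector)) set \<Rightarrow> 'v set \<Rightarrow> ('v \<Rightarrow> real) \<Rightarrow> bool" where
  "complex_banach_manifold X A V N \<longleftrightarrow>
     complex_banach_space V N \<and>
     Hausdorff_space X \<and>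
     (\<Union>(U, \<phi>)\<in>A. U) = topspace X \<and>
     (\<forall>(U, \<phi>)\<in>A. openin X U \<and> openin (norm_topology V N) (\<phi> ` U) \<and>
        homeomorphic_map (subtopology X U) (subtopology (norm_topology V N) (\<phi> ` U)) \<phi>) \<and>
     (\<forall>(U, \<phi>)\<in>A. \<forall>(U', \<psi>)\<in>A.
        holomorphic_map_on V N V N (\<phi> ` (U \<inter> U')) (\<psi> \<circ> inv_into U \<phi>))"

definition complex_hilbert_manifold ::
  "'p topology \<Rightarrow> ('p set \<times> ('p \<Rightarrow> 'v::complex_vector)) set \<Rightarrow> 'v set \<Rightarrow> ('v \<Rightarrow> 'v \<Rightarrow> complex) \<Rightarrow> bool" where
  "complex_hilbert_manifold X A V ip \<longleftrightarrow>
     complex_hilbert_space V ip \<and> complex_banach_manifold X A V (ip_norm ip)"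


section \<open>Compatible triples\<close>

definition bounded_isomorphism :: "('a::real_normed_vector \<Rightarrow> 'b::real_normed_vector) \<Rightarrow> bool" where
  "bounded_isomorphism f \<longleftrightarrow> bounded_linear f \<and> bij f \<and> bounded_linear (inv f)"

definition strong_form :: "('a::real_normed_vector \<Rightarrow> 'a \<Rightarrow> real) \<Rightarrow> bool" where
  "strong_form b \<longleftrightarrow>
     bounded_bilinear b \<and> bounded_isomorphism (\<lambda>v. Blinfun (b v) :: 'a \<Rightarrow>\<^sub>L real)"

definition strong_inner_product :: "('a::real_normed_vector \<Rightarrow> 'a \<Rightarrow> real) \<Rightarrow> bool" where
  "strong_inner_product g \<longleftrightarrow>
     strong_form g \<and> (\<forall>v w. g v w = g w v) \<and> (\<forall>v. 0 \<le> g v v)"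

definition strong_symplectic_form :: "('a::real_normed_vector \<Rightarrow> 'a \<Rightarrow> real) \<Rightarrow> bool" where
  "strong_symplectic_form \<omega> \<longleftrightarrow> strong_form \<omega> \<and> (\<forall>v w. \<omega> v w = - \<omega> w v)"

definition complex_structure :: "('a::real_normed_vector \<Rightarrow> 'a) \<Rightarrow> bool" where
  "complex_structure J \<longleftrightarrow> bounded_linear J \<and> (\<forall>v. J (J v) = - v)"

definition compatible_triple ::
  "('a::real_normed_vector \<Rightarrow> 'a \<Rightarrow> real) \<Rightarrow> ('a \<Rightarrow> 'a) \<Rightarrow> ('a \<Rightarrow> 'a \<Rightarrow> real) \<Rightarrow> bool" where
  "compatible_triple g J \<omega> \<longleftrightarrow>
     strong_inner_product g \<and> complex_structure J \<and> strong_symplectic_form \<omega> \<and>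
     (\<forall>v w. g v w = \<omega> v (J w))"


section \<open>Complexification\<close>

text \<open>\<open>Cplx v w\<close> is \<open>v \<otimes> 1 + w \<otimes> \<i>\<close>.\<close>

datatype 'a complexification = Cplx (re_part: 'a) (im_part: 'a)

instantiation complexification :: (real_vector) complex_vector
begin
definition zero_complexification_def: "0 = Cplx 0 0"
definition plus_complexification_def: "x + y = Cplx (re_part x + re_part y) (im_part x + im_part y)"
definition minus_complexification_def: "x - y = Cplx (re_part x - re_part y) (im_part x - im_part y)"
definition uminus_complexification_def: "- x = Cplx (- re_part x) (- im_part x)"
definition scaleC_complexification_def:
  "c *\<^sub>C x = Cplx (Re c *\<^sub>R re_part x - Im c *\<^sub>R im_part x) (Im c *\<^sub>R re_part x + Re c *\<^sub>R im_part x)"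
instance
  by standard
    (simp_all add: zero_complexification_def plus_complexification_def minus_complexification_def
      uminus_complexification_def scaleC_complexification_def algebra_simps scaleR_add_left complexification.expand)
end

text \<open>The conjugation \<open>\<alpha>\<close>, and the complex-linear resp. sesquilinear extensions of \<open>J\<close> and \<open>g\<close>.\<close>

definition conj_C :: "'a::real_vector complexification \<Rightarrow> 'a complexification" where
  "conj_C x = Cplx (re_part x) (- im_part x)"

definition ext_C :: "('a \<Rightarrow> 'a) \<Rightarrow> 'a complexification \<Rightarrow> 'a complexification" where
  "ext_C J x = Cplx (J (re_part x)) (J (im_part x))"

definition sesq_C :: "('a \<Rightarrow> 'a \<Rightarrow> real) \<Rightarrow> 'a complexification \<Rightarrow> 'a complexification \<Rightarrow> complex" where
  "sesq_C g x y =
     Complex (g (re_part x) (re_part y) + g (im_part x) (im_part y))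
             (g (im_part x) (re_part y) - g (re_part x) (im_part y))"

abbreviation norm_C :: "('a \<Rightarrow> 'a \<Rightarrow> real) \<Rightarrow> 'a complexification \<Rightarrow> real" where
  "norm_C g \<equiv> ip_norm (sesq_C g)"

definition L_plus :: "('a::real_vector \<Rightarrow> 'a) \<Rightarrow> 'a complexification set" where
  "L_plus J = {x. ext_C J x - \<i> *\<^sub>C x = 0}"

definition L_minus :: "('a::real_vector \<Rightarrow> 'a) \<Rightarrow> 'a complexification set" where
  "L_minus J = {x. ext_C J x + \<i> *\<^sub>C x = 0}"


section \<open>Operators between subspaces of the complexification\<close>

abbreviation bounded_ops_C :: "('a::real_vector \<Rightarrow> 'a \<Rightarrow> real) \<Rightarrow> 'a complexification set \<Rightarrow>
    'a complexification set \<Rightarrow> ('a complexification \<Rightarrow> 'a complexification) set" where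
  "bounded_ops_C g V W \<equiv> bounded_ops V (norm_C g) W (norm_C g)"

text \<open>The adjoint \<open>W \<rightarrow> V\<close> of \<open>T : V \<rightarrow> W\<close>.\<close>

definition adjoint_C :: "('a::real_vector \<Rightarrow> 'a \<Rightarrow> real) \<Rightarrow> 'a complexification set \<Rightarrow> 'a complexification set \<Rightarrow>
    ('a complexification \<Rightarrow> 'a complexification) \<Rightarrow> 'a complexification \<Rightarrow> 'a complexification" where
  "adjoint_C g V W T =
     (THE S. S \<in> bounded_ops_C g W V \<and> (\<forall>x\<in>V. \<forall>y\<in>W. sesq_C g (T x) y = sesq_C g x (S y)))"

text \<open>For self-adjoint \<open>T\<close> the number \<open>g(x, T x)\<close> is real.\<close>

definition strictly_positive :: "('a::real_vector \<Rightarrow> 'a \<Rightarrow> real) \<Rightarrow> 'a complexification set \<Rightarrow>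
    ('a complexification \<Rightarrow> 'a complexification) \<Rightarrow> bool" where
  "strictly_positive g V T \<longleftrightarrow>
     (\<forall>x\<in>V. \<forall>y\<in>V. sesq_C g (T x) y = sesq_C g x (T y)) \<and>
     (\<exists>c>0. \<forall>x\<in>V. Re (sesq_C g x (T x)) \<ge> c * Re (sesq_C g x x))"

definition orthonormal_basis_C :: "('a::real_vector \<Rightarrow> 'a \<Rightarrow> real) \<Rightarrow> 'a complexification set \<Rightarrow>
    'a complexification set \<Rightarrow> bool" where
  "orthonormal_basis_C g V E \<longleftrightarrow>
     E \<subseteq> V \<and>
     (\<forall>e\<in>E. \<forall>f\<in>E. sesq_C g e f = (if e = f then 1 else 0)) \<and>
     (\<forall>x\<in>V. \<forall>\<epsilon>>0. \<exists>y\<in>complex_vector.span E. norm_C g (x - y) < \<epsilon>)"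

definition hilbert_schmidt_ops :: "('a::real_vector \<Rightarrow> 'a \<Rightarrow> real) \<Rightarrow> 'a complexification set \<Rightarrow>
    'a complexification set \<Rightarrow> ('a complexification \<Rightarrow> 'a complexification) set" where
  "hilbert_schmidt_ops g V W =
     {T \<in> bounded_ops_C g V W.
        \<exists>E. orthonormal_basis_C g V E \<and> (\<lambda>e. (norm_C g (T e))\<^sup>2) summable_on E}"

text \<open>The value does not depend on the choice of the orthonormal basis.\<close>

definition hs_inner :: "('a::real_vector \<Rightarrow> 'a \<Rightarrow> real) \<Rightarrow> 'a complexification set \<Rightarrow>
    ('a complexification \<Rightarrow> 'a complexification) \<Rightarrow> ('a complexification \<Rightarrow> 'a complexification) \<Rightarrow> complex" where
  "hs_inner g V S T =
     (\<Sum>\<^sub>\<infinity>e\<in>(SOME E. orthonormal_basis_C g V E). sesq_C g (S e) (T e))"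


section \<open>Siegel disks\<close>

definition op_norm_L :: "('a::real_vector \<Rightarrow> 'a \<Rightarrow> real) \<Rightarrow> ('a \<Rightarrow> 'a) \<Rightarrow>
    ('a complexification \<Rightarrow> 'a complexification) \<Rightarrow> real" where
  "op_norm_L g J = op_norm (L_plus J) (norm_C g) (norm_C g)"

definition hs_inner_L :: "('a::real_vector \<Rightarrow> 'a \<Rightarrow> real) \<Rightarrow> ('a \<Rightarrow> 'a) \<Rightarrow>
    ('a complexification \<Rightarrow> 'a complexification) \<Rightarrow> ('a complexification \<Rightarrow> 'a complexification) \<Rightarrow> complex" where
  "hs_inner_L g J = hs_inner g (L_plus J)"

definition symmetric_ops :: "('a::real_vector \<Rightarrow> 'a \<Rightarrow> real) \<Rightarrow> ('a \<Rightarrow> 'a) \<Rightarrow>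
    ('a complexification \<Rightarrow> 'a complexification) set" where
  "symmetric_ops g J =
     {Z \<in> bounded_ops_C g (L_plus J) (L_minus J).
        conj_C \<circ> Z \<circ> conj_C = adjoint_C g (L_plus J) (L_minus J) Z}"

definition symmetric_hs_ops :: "('a::real_vector \<Rightarrow> 'a \<Rightarrow> real) \<Rightarrow> ('a \<Rightarrow> 'a) \<Rightarrow>
    ('a complexification \<Rightarrow> 'a complexification) set" where
  "symmetric_hs_ops g J =
     {Z \<in> hilbert_schmidt_ops g (L_plus J) (L_minus J).
        conj_C \<circ> Z \<circ> conj_C = adjoint_C g (L_plus J) (L_minus J) Z}"

definition siegel_disk :: "('a::real_vector \<Rightarrow> 'a \<Rightarrow> real) \<Rightarrow> ('a \<Rightarrow> 'a) \<Rightarrow>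
    ('a complexification \<Rightarrow> 'a complexification) set" where
  "siegel_disk g J =
     {Z \<in> bounded_ops_C g (L_plus J) (L_minus J).
        Z = conj_C \<circ> adjoint_C g (L_plus J) (L_minus J) Z \<circ> conj_C \<and>
        strictly_positive g (L_plus J) (\<lambda>x. x - adjoint_C g (L_plus J) (L_minus J) Z (Z x))}"

definition restricted_siegel_disk :: "('a::real_vector \<Rightarrow> 'a \<Rightarrow> real) \<Rightarrow> ('a \<Rightarrow> 'a) \<Rightarrow>
    ('a complexification \<Rightarrow> 'a complexification) set" where
  "restricted_siegel_disk g J = siegel_disk g J \<inter> hilbert_schmidt_ops g (L_plus J) (L_minus J)"

end

theory Submission
  imports Defs
begin

text \<open>
  Both disks turn out to be open unit balls of the operator norm, on two different carriers.

  The condition \<open>\<alpha> Z \<alpha> = Z\<^sup>*\<close> says that the complex-bilinear form \<open>(x, y) \<mapsto> g(Z x, \<alpha> y)\<close> on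
  \<open>L\<^sup>+\<close> is symmetric (\<open>conj_eq_adjoint_iff\<close>). This uses that adjoints exist, for which the strongness
  of \<open>g\<close> provides the Riesz vectors. In this form the condition is linear in \<open>Z\<close> and passes to pointwise
  limits, so the symmetric operators form a Banach space for the operator norm. Strict positivity of
  \<open>1 - Z\<^sup>*Z\<close> says that \<open>\<parallel>Z x\<parallel>\<^sup>2 \<le> (1 - c) \<parallel>x\<parallel>\<^sup>2\<close> for some \<open>c > 0\<close>, that is, that the operator norm of \<open>Z\<close> is
  less than \<open>1\<close> (\<open>siegel_disk_eq\<close>); this is an open condition.

  For the restricted disk, let \<open>E\<close> be an orthonormal basis of \<open>L\<^sup>+\<close>. Then \<open>\<alpha> E\<close> is one of \<open>L\<^sup>-\<close>, and
  a symmetric \<open>Z\<close> has a symmetric matrix \<open>g(Z e, \<alpha> f)\<close>. Exchanging rows and columns shows that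
  square summability of \<open>\<parallel>Z e\<parallel>\<close> does not depend on the basis (\<open>hs_summable_change_basis\<close>) and that the
  operator norm is at most the Hilbert-Schmidt norm (\<open>op_norm_le_hsn\<close>). Therefore Hilbert-Schmidt
  Cauchy sequences have limits among the symmetric operators, and the unit ball of the operator norm is also
  open for the Hilbert-Schmidt norm. Separability holds because finitely many vectors \<open>Z e\<close>, known up to
  a small error, determine \<open>Z\<close> up to a small error.

  An open subset of a complex Banach space is a manifold with the identity as its only chart.
\<close>

section \<open>Normed spaces on carriers\<close>

lemma
  assumes "complex_normed_space V N"
  shows normed_space_subspace: "complex_vector.subspace V"
    and normed_space_nonneg: "x \<in> V \<Longrightarrow> 0 \<le> N x"
    and normed_space_eq_0_iff: "x \<in> V \<Longrightarrow> N x = 0 \<longleftrightarrow> x = 0"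
    and normed_space_scale: "x \<in> V \<Longrightarrow> N (c *\<^sub>C x) = cmod c * N x"
    and normed_space_triangle: "x \<in> V \<Longrightarrow> y \<in> V \<Longrightarrow> N (x + y) \<le> N x + N y"
  using assms unfolding complex_normed_space_def by metis+

lemma normed_space_diff_commute:
  assumes "complex_normed_space V N" "x \<in> V" "y \<in> V"
  shows "N (x - y) = N (y - x)"
proof -
  have "y - x \<in> V" using complex_vector.subspace_diff[OF normed_space_subspace] assms by blast
  from normed_space_scale[OF assms(1) this, of "-1"] show ?thesis
    by (simp add: complex_vector.scale_minus_left scaleC_one)
qed

lemma Metric_space_norm_dist:
  assumes ns: "complex_normed_space V N"
  shows "Metric_space V (norm_dist V N)"
proof
  note diff = complex_vector.subspace_diff[OF normed_space_subspace[OF ns]]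
  note nonneg = normed_space_nonneg[OF ns] and eq_0 = normed_space_eq_0_iff[OF ns]
  show "0 \<le> norm_dist V N x y" for x y
    using nonneg[OF diff] by (simp add: norm_dist_def)
  show "norm_dist V N x y = norm_dist V N y x" for x y
    using normed_space_diff_commute[OF ns] by (simp add: norm_dist_def)
  show "(norm_dist V N x y = 0) = (x = y)" if "x \<in> V" "y \<in> V" for x y
    using eq_0[OF diff[OF that]] that by (simp add: norm_dist_def)
  show "norm_dist V N x z \<le> norm_dist V N x y + norm_dist V N y z"
    if "x \<in> V" "y \<in> V" "z \<in> V" for x y z
  proof -
    have "N ((x - y) + (y - z)) \<le> N (x - y) + N (y - z)"
      using diff that by (intro normed_space_triangle[OF ns]) auto
    then show ?thesis using that by (simp add: norm_dist_def)
  qed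
qed

lemma topspace_norm_topology:
  assumes "complex_normed_space V N"
  shows "topspace (norm_topology V N) = V"
  unfolding norm_topology_def
  by (simp add: Metric_space.topspace_mtopology[OF Metric_space_norm_dist[OF assms]])

lemma openin_norm_topology_iff:
  assumes "complex_normed_space V N"
  shows "openin (norm_topology V N) U \<longleftrightarrow>
    U \<subseteq> V \<and> (\<forall>x\<in>U. \<exists>r>0. \<forall>y\<in>V. N (x - y) < r \<longrightarrow> y \<in> U)"
proof -
  interpret M: Metric_space V "norm_dist V N" by (rule Metric_space_norm_dist[OF assms])
  have "M.mball x r \<subseteq> U \<longleftrightarrow> (\<forall>y\<in>V. N (x - y) < r \<longrightarrow> y \<in> U)" if "x \<in> V" for x r
    using that by (auto simp: M.in_mball norm_dist_def)
  then show ?thesis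
    unfolding norm_topology_def M.openin_mtopology by (metis subsetD)
qed

text \<open>The continuity estimate \<open>f y \<le> f x + N (y - x)\<close> is what a seminorm bounded by \<open>N\<close> satisfies.\<close>

lemma openin_norm_topology_sublevel:
  assumes "complex_normed_space V N"
    and "\<And>x y. x \<in> V \<Longrightarrow> y \<in> V \<Longrightarrow> f y \<le> f x + N (y - x)"
  shows "openin (norm_topology V N) {x \<in> V. f x < (a::real)}"
  unfolding openin_norm_topology_iff[OF assms(1)]
proof (intro conjI ballI)
  fix x assume x: "x \<in> {x \<in> V. f x < a}"
  show "\<exists>r>0. \<forall>y\<in>V. N (x - y) < r \<longrightarrow> y \<in> {x \<in> V. f x < a}"
  proof (intro exI conjI ballI impI)
    show "0 < a - f x" using x by simp
    fix y assume "y \<in> V" "N (x - y) < a - f x"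
    then show "y \<in> {x \<in> V. f x < a}"
      using assms(2)[of x y] normed_space_diff_commute[OF assms(1), of x y] x by auto
  qed
qed auto

lemma mcomplete_norm_distI:
  assumes ns: "complex_normed_space V N"
    and complete: "\<And>X. (\<And>n::nat. X n \<in> V) \<Longrightarrow>
        (\<And>\<epsilon>. \<epsilon> > 0 \<Longrightarrow> \<exists>k. \<forall>m\<ge>k. \<forall>n\<ge>k. N (X m - X n) < \<epsilon>) \<Longrightarrow>
        \<exists>x\<in>V. \<forall>\<epsilon>>0. \<exists>k. \<forall>n\<ge>k. N (X n - x) < \<epsilon>"
  shows "Metric_space.mcomplete V (norm_dist V N)"
proof -
  interpret M: Metric_space V "norm_dist V N" by (rule Metric_space_norm_dist[OF ns])
  show ?thesis unfolding M.mcomplete_def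
  proof (intro allI impI)
    fix X assume X: "M.MCauchy X"
    have V: "X n \<in> V" for n using X unfolding M.MCauchy_def by auto
    have "\<exists>k. \<forall>m\<ge>k. \<forall>n\<ge>k. N (X m - X n) < \<epsilon>" if "\<epsilon> > 0" for \<epsilon>
      using X that V unfolding M.MCauchy_def norm_dist_def by auto
    from complete[OF V this] obtain x where x: "x \<in> V" "\<forall>\<epsilon>>0. \<exists>k. \<forall>n\<ge>k. N (X n - x) < \<epsilon>"
      by blast
    then have "limitin M.mtopology X x sequentially"
      unfolding M.limitin_metric eventually_sequentially norm_dist_def using V by auto
    then show "\<exists>x. limitin M.mtopology X x sequentially" by blast
  qed
qed

text \<open>
  If, at every scale \<open>\<epsilon>\<close>, the points of \<open>V\<close> can be labelled by countably many labels so
  that equally labelled points are \<open>\<epsilon>\<close>-close, then one representative per label and scale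
  \<open>1 / n\<close> is a countable dense set. The labels need not be points of \<open>V\<close>, so that no
  approximating elements of \<open>V\<close> have to be constructed.
\<close>

lemma separable_space_norm_topologyI:
  assumes ns: "complex_normed_space V N"
    and label: "\<And>\<epsilon>. \<epsilon> > 0 \<Longrightarrow> \<exists>\<Phi> :: 'v::complex_vector \<Rightarrow> 'b. countable (\<Phi> ` V) \<and>
          (\<forall>x\<in>V. \<forall>y\<in>V. \<Phi> x = \<Phi> y \<longrightarrow> N (x - y) < \<epsilon>)"
  shows "separable_space (norm_topology V N)"
proof -
  interpret M: Metric_space V "norm_dist V N" by (rule Metric_space_norm_dist[OF ns])
  have "\<exists>\<Phi> :: 'v \<Rightarrow> 'b. countable (\<Phi> ` V) \<and>
          (\<forall>x\<in>V. \<forall>y\<in>V. \<Phi> x = \<Phi> y \<longrightarrow> N (x - y) < 1 / real (Suc n))" for n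
    by (rule label) simp
  then obtain \<Phi> :: "nat \<Rightarrow> 'v \<Rightarrow> 'b" where \<Phi>: "\<And>n. countable (\<Phi> n ` V)"
    "\<And>n x y. x \<in> V \<Longrightarrow> y \<in> V \<Longrightarrow> \<Phi> n x = \<Phi> n y \<Longrightarrow> N (x - y) < 1 / real (Suc n)"
    by metis
  define C where "C = (\<Union>n. inv_into V (\<Phi> n) ` (\<Phi> n ` V))"
  have "countable C" unfolding C_def using \<Phi>(1) by auto
  moreover have CV: "C \<subseteq> V" unfolding C_def by (auto intro: inv_into_into)
  moreover have "M.mtopology closure_of C = V"
    unfolding M.metric_closure_of
  proof safe
    fix x and r :: real assume x: "x \<in> V" and r: "r > 0"
    obtain n where n: "1 / real (Suc n) < r" using nat_approx_posE[OF r] by blast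
    define y where "y = inv_into V (\<Phi> n) (\<Phi> n x)"
    have y: "y \<in> V" "\<Phi> n y = \<Phi> n x" unfolding y_def using x by (auto intro: inv_into_into f_inv_into_f)
    have "N (x - y) < r" using \<Phi>(2)[of x y n] x y n by auto
    moreover have "y \<in> C" unfolding C_def y_def using x by blast
    ultimately show "\<exists>y\<in>C. y \<in> M.mball x r" using x y by (auto simp: M.in_mball norm_dist_def)
  qed
  ultimately show ?thesis unfolding separable_space_def norm_topology_def by auto
qed

text \<open>The identity is a chart, and its only transition map is the identity on the open set.\<close>

lemma complex_banach_manifold_openin:
  assumes V: "complex_banach_space V N" and D: "openin (norm_topology V N) D"
  shows "complex_banach_manifold (subtopology (norm_topology V N) D) {(D, \<lambda>Z. Z)} V N"
proof -
  have ns: "complex_normed_space V N" using V unfolding complex_banach_space_def by auto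
  interpret M: Metric_space V "norm_dist V N" by (rule Metric_space_norm_dist[OF ns])
  have DV: "D \<subseteq> V" using openin_subset[OF D] topspace_norm_topology[OF ns] by simp
  have haus: "Hausdorff_space (subtopology (norm_topology V N) D)"
    unfolding norm_topology_def by (intro Hausdorff_space_subtopology M.Hausdorff_space_mtopology)
  have inv: "inv_into D (\<lambda>Z. Z) x = x" if "x \<in> D" for x
    using f_inv_into_f[of x "\<lambda>Z. Z" D] that by simp
  define I where "I = (\<lambda>x. if x \<in> V then x else 0)"
  note sub = normed_space_subspace[OF ns]
  have I: "I \<in> bounded_ops V N V N"
    unfolding bounded_ops_def I_def
    using complex_vector.subspace_add[OF sub] complex_vector.subspace_scale[OF sub]
    by (auto intro!: exI[of _ 1])
  have N0: "N 0 = 0"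
    using normed_space_eq_0_iff[OF ns] complex_vector.subspace_0[OF sub] by blast
  have hol: "holomorphic_map_on V N V N D ((\<lambda>Z. Z) \<circ> inv_into D (\<lambda>Z. Z))"
    unfolding holomorphic_map_on_def
  proof (intro conjI ballI)
    show "((\<lambda>Z. Z) \<circ> inv_into D (\<lambda>Z. Z)) ` D \<subseteq> V" using inv DV by auto
    fix x assume x: "x \<in> D"
    show "\<exists>T\<in>bounded_ops V N V N. \<forall>\<epsilon>>0. \<exists>\<delta>>0. \<forall>y\<in>D. N (y - x) < \<delta> \<longrightarrow>
      N (((\<lambda>Z. Z) \<circ> inv_into D (\<lambda>Z. Z)) y - ((\<lambda>Z. Z) \<circ> inv_into D (\<lambda>Z. Z)) x - T (y - x))
      \<le> \<epsilon> * N (y - x)"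
    proof (intro bexI[OF _ I] allI impI exI[of _ "1::real"] conjI ballI)
      fix \<epsilon> :: real and y assume e: "\<epsilon> > 0" and y: "y \<in> D"
      have yx: "y - x \<in> V" using x y DV complex_vector.subspace_diff[OF sub] by auto
      then have "N (y - x) \<ge> 0" by (rule normed_space_nonneg[OF ns])
      then show "N (((\<lambda>Z. Z) \<circ> inv_into D (\<lambda>Z. Z)) y - ((\<lambda>Z. Z) \<circ> inv_into D (\<lambda>Z. Z)) x - I (y - x))
        \<le> \<epsilon> * N (y - x)"
        using x y inv yx e by (simp add: I_def N0)
    qed simp
  qed
  have top: "topspace (subtopology (norm_topology V N) D) = D"
    using DV topspace_norm_topology[OF ns] by auto
  have homeo: "homeomorphic_map (subtopology (subtopology (norm_topology V N) D) D)
      (subtopology (norm_topology V N) ((\<lambda>Z. Z) ` D)) (\<lambda>Z. Z)"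
    using homeomorphic_map_id by (auto simp: subtopology_subtopology id_def)
  show ?thesis
    unfolding complex_banach_manifold_def
    using V haus hol top D homeo by (auto simp: openin_subtopology_self openin_subtopology)
qed

section \<open>Inner products on carriers\<close>

text \<open>
  The carriers used below are the whole complexification, its subspace \<open>L\<^sup>+\<close>, and the space of symmetric
  Hilbert-Schmidt operators.
\<close>

locale carrier_inner_product =
  fixes V :: "'v::complex_vector set" and ip :: "'v \<Rightarrow> 'v \<Rightarrow> complex"
  assumes subspace: "complex_vector.subspace V"
    and add_left: "x \<in> V \<Longrightarrow> y \<in> V \<Longrightarrow> z \<in> V \<Longrightarrow> ip (x + y) z = ip x z + ip y z"
    and scale_left: "x \<in> V \<Longrightarrow> y \<in> V \<Longrightarrow> ip (c *\<^sub>C x) y = c * ip x y"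
    and hermitian: "x \<in> V \<Longrightarrow> y \<in> V \<Longrightarrow> ip y x = cnj (ip x y)"
    and positive: "x \<in> V \<Longrightarrow> x \<noteq> 0 \<Longrightarrow> 0 < Re (ip x x)"
begin

abbreviation nrm where "nrm \<equiv> ip_norm ip"

lemmas mem = complex_vector.subspace_0[OF subspace] complex_vector.subspace_add[OF subspace]
  complex_vector.subspace_diff[OF subspace] complex_vector.subspace_scale[OF subspace]

lemma add_right: "x \<in> V \<Longrightarrow> y \<in> V \<Longrightarrow> z \<in> V \<Longrightarrow> ip x (y + z) = ip x y + ip x z"
  using hermitian[of "y + z" x] hermitian[of y x] hermitian[of z x] add_left[of y z x] mem by simp

lemma scale_right: "x \<in> V \<Longrightarrow> y \<in> V \<Longrightarrow> ip x (c *\<^sub>C y) = cnj c * ip x y"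
  using hermitian[of "c *\<^sub>C y" x] hermitian[of y x] scale_left[of y x c] mem by simp

lemma zero_left: "x \<in> V \<Longrightarrow> ip 0 x = 0"
  using scale_left[of 0 x 0] mem by (simp add: complex_vector.scale_zero_left)

lemma zero_right: "x \<in> V \<Longrightarrow> ip x 0 = 0"
  using hermitian[of 0 x] zero_left[of x] mem by simp

lemma diff_left: "x \<in> V \<Longrightarrow> y \<in> V \<Longrightarrow> z \<in> V \<Longrightarrow> ip (x - y) z = ip x z - ip y z"
  using add_left[of "x - y" y z] mem by simp

lemma diff_right: "x \<in> V \<Longrightarrow> y \<in> V \<Longrightarrow> z \<in> V \<Longrightarrow> ip x (y - z) = ip x y - ip x z"
  using add_right[of x "y - z" z] mem by simp

lemma Re_ip_nonneg: "x \<in> V \<Longrightarrow> 0 \<le> Re (ip x x)"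
  using positive[of x] zero_left[of x] by (cases "x = 0") auto

lemma nrm_nonneg: "x \<in> V \<Longrightarrow> 0 \<le> nrm x"
  unfolding ip_norm_def using Re_ip_nonneg by simp

lemma nrm_sq: "x \<in> V \<Longrightarrow> (nrm x)\<^sup>2 = Re (ip x x)"
  unfolding ip_norm_def using Re_ip_nonneg by simp

lemma ip_self: "x \<in> V \<Longrightarrow> ip x x = of_real ((nrm x)\<^sup>2)"
  using nrm_sq hermitian[of x x] by (simp add: complex_eq_iff)

lemma nrm_eq_0_iff: "x \<in> V \<Longrightarrow> nrm x = 0 \<longleftrightarrow> x = 0"
  using nrm_sq[of x] positive[of x] zero_left[of x] by fastforce

lemma nrm_scale: "x \<in> V \<Longrightarrow> nrm (c *\<^sub>C x) = cmod c * nrm x"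
proof -
  assume x: "x \<in> V"
  have "ip (c *\<^sub>C x) (c *\<^sub>C x) = c * cnj c * ip x x"
    using x by (simp add: scale_left scale_right mem)
  also have "\<dots> = of_real ((cmod c * nrm x)\<^sup>2)"
    using ip_self[OF x] by (simp add: power_mult_distrib flip: complex_norm_square)
  finally show ?thesis
    using nrm_nonneg[OF x] by (simp add: ip_norm_def[of ip "c *\<^sub>C x"] del: of_real_power)
qed

lemma nrm_sq_diff_scale:
  assumes "x \<in> V" "y \<in> V"
  shows "(nrm (x - c *\<^sub>C y))\<^sup>2 = (nrm x)\<^sup>2 - 2 * Re (cnj c * ip x y) + (cmod c)\<^sup>2 * (nrm y)\<^sup>2"
proof -
  have "ip (x - c *\<^sub>C y) (x - c *\<^sub>C y)
      = ip x x - cnj c * ip x y - c * cnj (ip x y) + of_real ((cmod c)\<^sup>2) * ip y y"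
    using assms hermitian[of x y]
    by (simp add: diff_left diff_right scale_left scale_right mem complex_norm_square algebra_simps
        del: of_real_power)
  then have "Re (ip (x - c *\<^sub>C y) (x - c *\<^sub>C y))
      = Re (ip x x) - 2 * Re (cnj c * ip x y) + (cmod c)\<^sup>2 * Re (ip y y)"
    by (simp del: of_real_power)
  then show ?thesis using assms by (simp add: nrm_sq mem)
qed

lemma cauchy_schwarz:
  assumes x: "x \<in> V" and y: "y \<in> V"
  shows "cmod (ip x y) \<le> nrm x * nrm y"
proof (cases "y = 0")
  case True
  then show ?thesis using zero_right[OF x] nrm_nonneg x y by simp
next
  case False
  then have pos: "nrm y > 0" using nrm_eq_0_iff nrm_nonneg y by fastforce
  (* c y is the projection of x to the line through y. *)
  define c where "c = ip x y / of_real ((nrm y)\<^sup>2)"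
  have "Re (cnj c * ip x y) = (cmod (ip x y))\<^sup>2 / (nrm y)\<^sup>2"
    unfolding c_def by (simp add: Re_divide_of_real cmod_power2 power2_eq_square[of "Re _"]
        power2_eq_square[of "Im _"] del: of_real_power)
  moreover have "(cmod c)\<^sup>2 * (nrm y)\<^sup>2 = (cmod (ip x y))\<^sup>2 / (nrm y)\<^sup>2"
    unfolding c_def using pos by (simp add: norm_divide norm_mult power2_eq_square field_simps)
  ultimately have "0 \<le> (nrm x)\<^sup>2 - (cmod (ip x y))\<^sup>2 / (nrm y)\<^sup>2"
    using nrm_sq_diff_scale[OF x y, of c] zero_le_power2[of "nrm (x - c *\<^sub>C y)"] by linarith
  then have "(cmod (ip x y))\<^sup>2 \<le> (nrm x * nrm y)\<^sup>2"
    using pos by (simp add: field_simps)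
  then show ?thesis by (rule power2_le_imp_le) (simp add: nrm_nonneg x y)
qed

lemma triangle:
  assumes "x \<in> V" "y \<in> V"
  shows "nrm (x + y) \<le> nrm x + nrm y"
proof -
  have "(nrm (x + y))\<^sup>2 = (nrm x)\<^sup>2 + 2 * Re (ip x y) + (nrm y)\<^sup>2"
    using nrm_sq_diff_scale[of x y "-1"] assms
    by (simp add: complex_vector.scale_minus_left scaleC_one)
  also have "\<dots> \<le> (nrm x)\<^sup>2 + 2 * (nrm x * nrm y) + (nrm y)\<^sup>2"
    using cauchy_schwarz[OF assms] complex_Re_le_cmod[of "ip x y"] by simp
  also have "\<dots> = (nrm x + nrm y)\<^sup>2" by (simp add: power2_sum)
  finally show ?thesis by (rule power2_le_imp_le) (simp add: nrm_nonneg assms)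
qed

lemma nrm_sq_diff_le:
  assumes "x \<in> V" "y \<in> V"
  shows "(nrm (x - y))\<^sup>2 \<le> 2 * (nrm x)\<^sup>2 + 2 * (nrm y)\<^sup>2"
proof -
  have "nrm (x - y) \<le> nrm x + nrm (- y)"
    using triangle[of x "- y"] assms complex_vector.subspace_neg[OF subspace] by simp
  also have "nrm (- y) = nrm y"
    using nrm_scale[of y "-1"] assms by (simp add: complex_vector.scale_minus_left scaleC_one)
  finally have "(nrm (x - y))\<^sup>2 \<le> (nrm x + nrm y)\<^sup>2"
    using nrm_nonneg assms mem by (intro power_mono) auto
  also have "\<dots> \<le> 2 * (nrm x)\<^sup>2 + 2 * (nrm y)\<^sup>2"
    using sum_squares_bound[of "nrm x" "nrm y"] by (simp add: power2_sum)
  finally show ?thesis .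
qed

lemma normed_space: "complex_normed_space V nrm"
  unfolding complex_normed_space_def
  using subspace nrm_nonneg nrm_eq_0_iff nrm_scale triangle by blast

lemma complex_hilbert_spaceI:
  assumes "Metric_space.mcomplete V (norm_dist V nrm)" and "separable_space (norm_topology V nrm)"
  shows "complex_hilbert_space V ip"
  unfolding complex_hilbert_space_def
  using subspace add_left scale_left hermitian positive assms by blast

end

definition orthonormal_on :: "('v \<Rightarrow> 'v \<Rightarrow> complex) \<Rightarrow> 'v set \<Rightarrow> bool" where
  "orthonormal_on ip E \<longleftrightarrow> (\<forall>e\<in>E. \<forall>f\<in>E. ip e f = (if e = f then 1 else 0))"

lemma orthonormal_on_subset: "orthonormal_on ip E \<Longrightarrow> F \<subseteq> E \<Longrightarrow> orthonormal_on ip F"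
  unfolding orthonormal_on_def by blast

context carrier_inner_product
begin

lemma sum_mem: "finite F \<Longrightarrow> F \<subseteq> V \<Longrightarrow> (\<Sum>e\<in>F. a e *\<^sub>C e) \<in> V"
  by (meson complex_vector.subspace_scale complex_vector.subspace_sum subset_iff subspace)

lemma ip_sum_left:
  assumes "finite F" "F \<subseteq> V" "y \<in> V"
  shows "ip (\<Sum>e\<in>F. a e *\<^sub>C e) y = (\<Sum>e\<in>F. a e * ip e y)"
  using assms by (induction F rule: finite_induct) (simp_all add: zero_left add_left scale_left mem sum_mem)

text \<open>
  The distance from \<open>x\<close> to a finite linear combination is smallest for the Fourier coefficients;
  Bessel's inequality is the case where these are the coefficients.
\<close>

lemma best_approximation:
  assumes "finite F" "F \<subseteq> V" "orthonormal_on ip F" "x \<in> V"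
  shows "(nrm (x - (\<Sum>e\<in>F. a e *\<^sub>C e)))\<^sup>2
    = (nrm x)\<^sup>2 - (\<Sum>e\<in>F. (cmod (ip x e))\<^sup>2) + (\<Sum>e\<in>F. (cmod (a e - ip x e))\<^sup>2)"
  using assms
proof (induction F rule: finite_induct)
  case empty
  then show ?case by simp
next
  case (insert f F)
  have F: "F \<subseteq> V" "f \<in> V" "orthonormal_on ip F" using insert.prems by (auto simp: orthonormal_on_def)
  define w where "w = x - (\<Sum>e\<in>F. a e *\<^sub>C e)"
  have w: "w \<in> V" unfolding w_def using F insert by (simp add: mem sum_mem)
  have "(\<Sum>e\<in>F. a e * ip e f) = 0"
    using insert by (intro sum.neutral) (auto simp: orthonormal_on_def)
  then have "ip w f = ip x f"
    unfolding w_def using F insert by (simp add: diff_left sum_mem ip_sum_left)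
  moreover have "nrm f = 1"
    using insert.prems(2) by (simp add: orthonormal_on_def ip_norm_def)
  ultimately have "(nrm (w - a f *\<^sub>C f))\<^sup>2 = (nrm w)\<^sup>2 - 2 * Re (cnj (a f) * ip x f) + (cmod (a f))\<^sup>2"
    using nrm_sq_diff_scale[OF w F(2), of "a f"] by simp
  also have "\<dots> = (nrm w)\<^sup>2 - (cmod (ip x f))\<^sup>2 + (cmod (a f - ip x f))\<^sup>2"
    by (simp add: cmod_power2 power2_diff algebra_simps)
  also have "w - a f *\<^sub>C f = x - (\<Sum>e\<in>insert f F. a e *\<^sub>C e)"
    using insert by (simp add: w_def algebra_simps)
  also have "(nrm w)\<^sup>2 = (nrm x)\<^sup>2 - (\<Sum>e\<in>F. (cmod (ip x e))\<^sup>2) + (\<Sum>e\<in>F. (cmod (a e - ip x e))\<^sup>2)"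
    unfolding w_def using insert F by blast
  finally show ?case using insert by simp
qed

lemma bessel:
  assumes "finite F" "F \<subseteq> V" "orthonormal_on ip F" "x \<in> V"
  shows "(\<Sum>e\<in>F. (cmod (ip x e))\<^sup>2) \<le> (nrm x)\<^sup>2"
  using best_approximation[OF assms, of "ip x"] zero_le_power2[of "nrm (x - (\<Sum>e\<in>F. ip x e *\<^sub>C e))"]
  by simp

text \<open>
  The finite sums stay below \<open>(nrm x)\<^sup>2\<close> by Bessel; density and best approximation let them come
  arbitrarily close.
\<close>

lemma parseval:
  assumes E: "E \<subseteq> V" "orthonormal_on ip E"
    and x: "x \<in> V" and dense: "\<And>\<epsilon>. \<epsilon> > 0 \<Longrightarrow> \<exists>y\<in>complex_vector.span E. nrm (x - y) < \<epsilon>"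
  shows "((\<lambda>e. (cmod (ip x e))\<^sup>2) has_sum (nrm x)\<^sup>2) E"
proof -
  let ?f = "\<lambda>e. (cmod (ip x e))\<^sup>2"
  have le: "sum ?f F \<le> (nrm x)\<^sup>2" if "finite F" "F \<subseteq> E" for F
    using that E x by (intro bessel) (auto intro: orthonormal_on_subset)
  have summ: "?f summable_on E"
    by (rule nonneg_bdd_above_summable_on) (auto simp: bdd_above_def intro: le)
  have "infsum ?f E \<le> (nrm x)\<^sup>2" by (rule infsum_le_finite_sums[OF summ le])
  moreover have "(nrm x)\<^sup>2 \<le> infsum ?f E"
  proof (rule field_le_epsilon)
    fix \<epsilon> :: real assume "\<epsilon> > 0"
    then have "sqrt \<epsilon> > 0" by simp
    then obtain y where y: "y \<in> complex_vector.span E" "nrm (x - y) < sqrt \<epsilon>" using dense by blast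
    obtain F a where F: "finite F" "F \<subseteq> E" and ya: "y = (\<Sum>e\<in>F. a e *\<^sub>C e)"
      using y(1) unfolding complex_vector.span_explicit by blast
    have FV: "F \<subseteq> V" "orthonormal_on ip F" using F E by (auto intro: orthonormal_on_subset)
    have "y \<in> V" unfolding ya using F FV by (simp add: sum_mem)
    then have "(nrm (x - y))\<^sup>2 < (sqrt \<epsilon>)\<^sup>2"
      using y(2) nrm_nonneg x mem by (intro power_strict_mono) auto
    then have "(nrm x)\<^sup>2 - sum ?f F + (\<Sum>e\<in>F. (cmod (a e - ip x e))\<^sup>2) < \<epsilon>"
      using best_approximation[OF F(1) FV x, of a] ya \<open>\<epsilon> > 0\<close> by simp
    moreover have "0 \<le> (\<Sum>e\<in>F. (cmod (a e - ip x e))\<^sup>2)" by (simp add: sum_nonneg)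
    moreover have "sum ?f F \<le> infsum ?f E" using finite_sum_le_infsum[OF summ F] by simp
    ultimately show "(nrm x)\<^sup>2 \<le> infsum ?f E + \<epsilon>" by linarith
  qed
  ultimately show ?thesis using summ by (metis order_antisym has_sum_infsum)
qed

text \<open>
  Gram-Schmidt: the normalised rest of \<open>x\<close> after subtracting its projection is added to \<open>F\<close>, or
  nothing if there is no rest.
\<close>

lemma gram_schmidt_step:
  assumes F: "finite F" "F \<subseteq> V" "orthonormal_on ip F" and x: "x \<in> V"
  obtains F' where "finite F'" "F' \<subseteq> V" "orthonormal_on ip F'" "F \<subseteq> F'" "x \<in> complex_vector.span F'"
proof -
  define p where "p = (\<Sum>e\<in>F. ip x e *\<^sub>C e)"
  have pV: "p \<in> V" unfolding p_def by (rule sum_mem[OF F(1,2)])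
  have p_span: "p \<in> complex_vector.span F"
    unfolding p_def by (intro complex_vector.span_sum complex_vector.span_scale complex_vector.span_base)
  show ?thesis
  proof (cases "x = p")
    case True
    then show ?thesis using that[of F] F p_span by simp
  next
    case False
    define y where "y = x - p"
    have y: "y \<in> V" "y \<noteq> 0" using False pV x by (simp_all add: y_def mem)
    have n: "nrm y > 0" using nrm_eq_0_iff[OF y(1)] nrm_nonneg[OF y(1)] y(2) by simp
    define u where "u = complex_of_real (1 / nrm y) *\<^sub>C y"
    have uV: "u \<in> V" using y by (simp add: u_def mem)
    have "nrm u = 1" using n y by (simp add: u_def nrm_scale norm_divide)
    then have uu: "ip u u = 1" using ip_self[OF uV] by simp
    have ue: "ip u e = 0" if e: "e \<in> F" for e
    proof -
      have eV: "e \<in> V" using e F by blast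
      have "ip p e = (\<Sum>f\<in>F. ip x f * ip f e)" unfolding p_def by (rule ip_sum_left[OF F(1,2) eV])
      also have "\<dots> = (\<Sum>f\<in>F. if f = e then ip x f else 0)"
        using F(3) e by (intro sum.cong) (auto simp: orthonormal_on_def)
      also have "\<dots> = ip x e" using F(1) e by simp
      finally show ?thesis using y(1) eV x pV by (simp add: u_def scale_left y_def diff_left mem)
    qed
    have eu: "ip e u = 0" if "e \<in> F" for e
      using ue[OF that] hermitian[of u e] that F uV by auto
    have "x = p + complex_of_real (nrm y) *\<^sub>C u"
      using n by (simp add: u_def scaleC_scaleC scaleC_one y_def)
    moreover have "p \<in> complex_vector.span (insert u F)"
      using p_span complex_vector.span_mono[of F "insert u F"] by blast
    ultimately have "x \<in> complex_vector.span (insert u F)"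
      by (simp add: complex_vector.span_add complex_vector.span_scale complex_vector.span_base)
    moreover have "u \<notin> F" using ue[of u] uu by auto
    then have "orthonormal_on ip (insert u F)"
      using F(3) uu ue eu by (auto simp: orthonormal_on_def)
    ultimately show ?thesis using that[of "insert u F"] F uV by auto
  qed
qed

end

lemma complex_banach_space_of_hilbert:
  assumes "complex_hilbert_space V ip"
  shows "complex_banach_space V (ip_norm ip)"
proof -
  interpret carrier_inner_product V ip
    using assms unfolding complex_hilbert_space_def by unfold_locales blast+
  show ?thesis using assms normed_space unfolding complex_hilbert_space_def complex_banach_space_def by blast
qed

section \<open>The complexified Hilbert space\<close>

text \<open>
  The Cauchy-Schwarz inequality is needed before definiteness is known: it enters the proof that \<open>g\<close> is
  definite.
\<close>

lemma semidefinite_cauchy_schwarz: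
  fixes b :: "'a::real_vector \<Rightarrow> 'a \<Rightarrow> real"
  assumes "bilinear b" and sym: "\<And>v w. b v w = b w v" and nonneg: "\<And>v. 0 \<le> b v v"
  shows "(b v w)\<^sup>2 \<le> b v v * b w w"
proof -
  have poly: "0 \<le> b v v + 2 * t * b v w + t\<^sup>2 * b w w" for t
    using nonneg[of "v + t *\<^sub>R w"] sym[of w v]
    by (simp add: bilinear_ladd[OF assms(1)] bilinear_radd[OF assms(1)] bilinear_lmul[OF assms(1)]
        bilinear_rmul[OF assms(1)] power2_eq_square algebra_simps)
  show ?thesis
  proof (cases "b w w = 0")
    case True
    have "b v w = 0"
    proof (rule ccontr)
      assume "b v w \<noteq> 0"
      then show False using poly[of "- (b v v + 1) / (2 * b v w)"] True by (simp add: field_simps)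
    qed
    then show ?thesis using True by simp
  next
    case False
    then have "b w w > 0" using nonneg[of w] by simp
    then show ?thesis
      using poly[of "- b v w / b w w"] by (simp add: field_simps power2_eq_square)
  qed
qed

lemmas complexification_simps =
  zero_complexification_def plus_complexification_def minus_complexification_def
  uminus_complexification_def scaleC_complexification_def

text \<open>
  Limits in the complexification are taken in both components, so that the limit rules of the
  underlying real space apply.
\<close>

definition tends_C :: "(nat \<Rightarrow> 'a::real_normed_vector complexification) \<Rightarrow> 'a complexification \<Rightarrow> bool" where
  "tends_C X x \<longleftrightarrow> (\<lambda>n. re_part (X n)) \<longlonglongrightarrow> re_part x \<and> (\<lambda>n. im_part (X n)) \<longlonglongrightarrow> im_part x"

lemma tends_C_unique: "tends_C X x \<Longrightarrow> tends_C X y \<Longrightarrow> x = y"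
  unfolding tends_C_def by (metis LIMSEQ_unique complexification.expand)

lemma tends_C_const: "tends_C (\<lambda>n. x) x"
  unfolding tends_C_def by simp

lemma tends_C_add: "tends_C X x \<Longrightarrow> tends_C Y y \<Longrightarrow> tends_C (\<lambda>n. X n + Y n) (x + y)"
  unfolding tends_C_def complexification_simps complexification.sel by (simp add: tendsto_add tendsto_diff tendsto_scaleR)

lemma tends_C_diff: "tends_C X x \<Longrightarrow> tends_C Y y \<Longrightarrow> tends_C (\<lambda>n. X n - Y n) (x - y)"
  unfolding tends_C_def complexification_simps complexification.sel by (simp add: tendsto_add tendsto_diff tendsto_scaleR)

lemma tends_C_scale: "tends_C X x \<Longrightarrow> tends_C (\<lambda>n. c *\<^sub>C X n) (c *\<^sub>C x)"
  unfolding tends_C_def complexification_simps complexification.sel by (simp add: tendsto_add tendsto_diff tendsto_scaleR)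

lemma tends_C_ext:
  "bounded_linear J \<Longrightarrow> tends_C X x \<Longrightarrow> tends_C (\<lambda>n. ext_C J (X n)) (ext_C J x)"
  unfolding tends_C_def by (simp add: ext_C_def bounded_linear.tendsto[of J])

lemma tends_C_sesq:
  assumes "bounded_bilinear g" "tends_C X x" "tends_C Y y"
  shows "(\<lambda>n. sesq_C g (X n) (Y n)) \<longlonglongrightarrow> sesq_C g x y"
  using assms unfolding tends_C_def sesq_C_def
  by (intro tendsto_Complex tendsto_intros bounded_bilinear.tendsto[OF assms(1)]) auto

lemma tends_C_norm:
  assumes "bounded_bilinear g" "tends_C X x"
  shows "(\<lambda>n. norm_C g (X n)) \<longlonglongrightarrow> norm_C g x"
  unfolding ip_norm_def using tends_C_sesq[OF assms(1,2,2)] by (intro tendsto_intros)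

lemma conj_C_conj_C [simp]: "conj_C (conj_C x) = x"
  by (simp add: conj_C_def)

lemma conj_C_add: "conj_C (x + y) = conj_C x + conj_C y"
  by (simp add: conj_C_def complexification_simps)

lemma conj_C_scale: "conj_C (c *\<^sub>C x) = cnj c *\<^sub>C conj_C x"
  by (simp add: conj_C_def complexification_simps)

lemma conj_C_zero [simp]: "conj_C 0 = 0"
  by (simp add: conj_C_def complexification_simps)

locale siegel_setting =
  fixes g \<omega> :: "'a::{real_inner, complete_space} \<Rightarrow> 'a \<Rightarrow> real"
    and J :: "'a \<Rightarrow> 'a"
  assumes separable: "separable_space (euclidean :: 'a topology)"
    and triple: "compatible_triple g J \<omega>"
begin

lemma bilinear_g: "bounded_bilinear g"
  using triple unfolding compatible_triple_def strong_inner_product_def strong_form_def by blast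

lemma g_sym: "g v w = g w v" and g_nonneg: "0 \<le> g v v"
  using triple unfolding compatible_triple_def strong_inner_product_def by metis+

lemma J_bounded: "bounded_linear J" and J_J: "J (J v) = - v"
  using triple unfolding compatible_triple_def complex_structure_def by metis+

lemmas g_simps = bounded_bilinear.add_left[OF bilinear_g] bounded_bilinear.add_right[OF bilinear_g]
  bounded_bilinear.diff_left[OF bilinear_g] bounded_bilinear.diff_right[OF bilinear_g]
  bounded_bilinear.minus_left[OF bilinear_g] bounded_bilinear.minus_right[OF bilinear_g]
  bounded_bilinear.scaleR_left[OF bilinear_g] bounded_bilinear.scaleR_right[OF bilinear_g]
  bounded_bilinear.zero_left[OF bilinear_g] bounded_bilinear.zero_right[OF bilinear_g]

lemmas J_simps = linear_add[OF bounded_linear.linear[OF J_bounded]]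
  linear_diff[OF bounded_linear.linear[OF J_bounded]] linear_neg[OF bounded_linear.linear[OF J_bounded]]
  linear_scale[OF bounded_linear.linear[OF J_bounded]] linear_0[OF bounded_linear.linear[OF J_bounded]]

text \<open>\<open>J\<close> is skew for \<open>g\<close>, because \<open>\<omega>(v, w) = - g(v, J w)\<close> is antisymmetric.\<close>

lemma g_J: "g (J v) w = - g v (J w)"
proof -
  have \<omega>: "g v w = \<omega> v (J w)" "\<omega> v w = - \<omega> w v" for v w
    using triple unfolding compatible_triple_def strong_symplectic_form_def by metis+
  have "\<omega> v w = - g v (J w)" for v w
    using \<omega>(1)[of v "- J w"] by (simp add: J_simps J_J g_simps)
  from this[of v w] this[of w v] have "g v (J w) = - g w (J v)" using \<omega>(2)[of v w] by simp
  then show ?thesis using g_sym[of "J v" w] by simp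
qed

text \<open>Strongness of \<open>g\<close> is the Riesz representation theorem for the real space.\<close>

lemma riesz_real:
  assumes "bounded_linear \<phi>"
  shows "\<exists>v. \<forall>w. g v w = \<phi> w"
proof -
  have "bij (\<lambda>v. Blinfun (g v))"
    using triple
    unfolding compatible_triple_def strong_inner_product_def strong_form_def bounded_isomorphism_def
    by blast
  then obtain v where "Blinfun (g v) = Blinfun \<phi>" by (metis bij_pointE)
  then have "blinfun_apply (Blinfun (g v)) = blinfun_apply (Blinfun \<phi>)" by simp
  then have "g v = \<phi>"
    using assms bounded_bilinear.bounded_linear_right[OF bilinear_g]
    by (simp add: bounded_linear_Blinfun_apply)
  then show ?thesis by blast
qed

text \<open>
  By strongness \<open>v\<close> is controlled by the functional \<open>g v\<close>, whose norm is at most a multiple of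
  \<open>sqrt (g v v)\<close> by the Cauchy-Schwarz inequality.
\<close>

lemma g_norm_equiv:
  obtains c C where "c > 0" "C > 0"
    "\<And>v. norm v \<le> c * sqrt (g v v)" "\<And>v. sqrt (g v v) \<le> C * norm v"
proof -
  obtain B where B: "B > 0" "\<And>v w. norm (g v w) \<le> norm v * norm w * B"
    using bounded_bilinear.pos_bounded[OF bilinear_g] by blast
  let ?f = "\<lambda>v. Blinfun (g v)"
  have f: "bij ?f" "bounded_linear (inv ?f)"
    using triple
    unfolding compatible_triple_def strong_inner_product_def strong_form_def bounded_isomorphism_def
    by blast+
  obtain K where K: "K > 0" "\<And>x. norm (inv ?f x) \<le> norm x * K"
    using bounded_linear.pos_bounded[OF f(2)] by blast
  have up: "sqrt (g v v) \<le> sqrt B * norm v" for v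
  proof -
    have "g v v \<le> norm v * norm v * B" using B(2)[of v v] by simp
    then have "sqrt (g v v) \<le> sqrt (norm v * norm v * B)" by (rule real_sqrt_le_mono)
    then show ?thesis by (simp add: real_sqrt_mult mult.commute)
  qed
  have low: "norm v \<le> (K * sqrt B) * sqrt (g v v)" for v
  proof -
    have "norm (?f v) \<le> sqrt (g v v) * sqrt B"
    proof (rule norm_blinfun_bound)
      show "0 \<le> sqrt (g v v) * sqrt B" using B g_nonneg by simp
      fix w
      have "(g v w)\<^sup>2 \<le> g v v * g w w"
        by (rule semidefinite_cauchy_schwarz)
          (auto simp: g_sym g_nonneg bilinear_conv_bounded_bilinear[symmetric] bilinear_def linear_iff g_simps)
      then have "\<bar>g v w\<bar> \<le> sqrt (g v v * g w w)"
        using real_sqrt_le_mono by fastforce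
      also have "\<dots> \<le> sqrt (g v v) * (sqrt B * norm w)"
        using up[of w] g_nonneg[of v] by (simp add: real_sqrt_mult mult_left_mono)
      finally show "norm (blinfun_apply (?f v) w) \<le> sqrt (g v v) * sqrt B * norm w"
        using bounded_bilinear.bounded_linear_right[OF bilinear_g, of v]
        by (simp add: bounded_linear_Blinfun_apply mult.assoc)
    qed
    then have "norm (?f v) * K \<le> sqrt (g v v) * sqrt B * K" using K(1) by (simp add: mult_right_mono)
    moreover have "inv ?f (?f v) = v" by (rule inv_f_f[OF bij_is_inj[OF f(1)]])
    ultimately show ?thesis using K(2)[of "?f v"] by (simp add: mult_ac)
  qed
  show ?thesis using that[OF _ _ low up] B K by simp
qed

lemma g_pos: "v \<noteq> 0 \<Longrightarrow> 0 < g v v"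
proof -
  assume v: "v \<noteq> 0"
  obtain c where "norm v \<le> c * sqrt (g v v)" by (rule g_norm_equiv) blast
  then have "g v v \<noteq> 0" using v by auto
  then show ?thesis using g_nonneg[of v] by simp
qed

sublocale H: carrier_inner_product UNIV "sesq_C g"
proof
  show "complex_vector.subspace UNIV" by simp
  show "sesq_C g (x + y) z = sesq_C g x z + sesq_C g y z" for x y z
    by (simp add: sesq_C_def complexification_simps g_simps complex_eq_iff)
  show "sesq_C g (c *\<^sub>C x) y = c * sesq_C g x y" for c x y
    by (simp add: sesq_C_def complexification_simps g_simps complex_eq_iff algebra_simps)
  show "sesq_C g y x = cnj (sesq_C g x y)" for x y
    by (simp add: sesq_C_def g_sym complex_eq_iff)
  show "0 < Re (sesq_C g x x)" if "x \<noteq> 0" for x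
  proof (cases "re_part x = 0")
    case True
    then have "im_part x \<noteq> 0"
      using that by (metis complexification.expand complexification.sel zero_complexification_def)
    then show ?thesis using g_pos[of "im_part x"] g_nonneg[of "re_part x"] by (simp add: sesq_C_def)
  next
    case False
    then show ?thesis using g_pos[of "re_part x"] g_nonneg[of "im_part x"] by (simp add: sesq_C_def)
  qed
qed

lemmas H_simps = H.add_left[OF UNIV_I UNIV_I UNIV_I] H.add_right[OF UNIV_I UNIV_I UNIV_I]
  H.diff_left[OF UNIV_I UNIV_I UNIV_I] H.diff_right[OF UNIV_I UNIV_I UNIV_I]
  H.scale_left[OF UNIV_I UNIV_I] H.scale_right[OF UNIV_I UNIV_I]
  H.zero_left[OF UNIV_I] H.zero_right[OF UNIV_I]

lemmas norm_nonneg = H.nrm_nonneg[OF UNIV_I] and norm_scale = H.nrm_scale[OF UNIV_I]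
  and norm_eq_0_iff = H.nrm_eq_0_iff[OF UNIV_I] and norm_triangle = H.triangle[OF UNIV_I UNIV_I]
  and norm_diff_commute = normed_space_diff_commute[OF H.normed_space UNIV_I UNIV_I]

lemma norm_C_0 [simp]: "norm_C g 0 = 0"
  using norm_eq_0_iff[of 0] by blast

lemma sesq_conj: "sesq_C g (conj_C x) (conj_C y) = cnj (sesq_C g x y)"
  by (simp add: sesq_C_def conj_C_def g_simps complex_eq_iff)

lemma norm_conj [simp]: "norm_C g (conj_C x) = norm_C g x"
  by (simp add: ip_norm_def sesq_conj)

text \<open>Completeness: \<open>g\<close> defines an equivalent norm on the complete space of each component.\<close>

lemma norm_C_convergent:
  assumes "\<And>\<epsilon>. \<epsilon> > 0 \<Longrightarrow> \<exists>k. \<forall>m\<ge>k. \<forall>n\<ge>k. norm_C g (X m - X n) < \<epsilon>"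
  shows "\<exists>x. tends_C X x"
proof -
  obtain c where c: "c > 0" "\<And>v. norm v \<le> c * sqrt (g v v)" by (rule g_norm_equiv) blast
  have part: "norm (re_part x) \<le> c * norm_C g x" "norm (im_part x) \<le> c * norm_C g x" for x
    using c(2)[of "re_part x"] c(2)[of "im_part x"] c(1) g_nonneg
    by (auto intro!: order_trans[OF c(2)] mult_left_mono real_sqrt_le_mono simp: ip_norm_def sesq_C_def)
  have "Cauchy (\<lambda>n. re_part (X n)) \<and> Cauchy (\<lambda>n. im_part (X n))"
    unfolding Cauchy_def
  proof (intro conjI allI impI)
    fix e :: real assume "e > 0"
    then have "e / c > 0" using c by simp
    then obtain k where k: "\<forall>m\<ge>k. \<forall>n\<ge>k. norm_C g (X m - X n) < e / c" using assms by blast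
    have small: "c * norm_C g (X m - X n) < e" if "m \<ge> k" "n \<ge> k" for m n
      using k that c(1) by (simp add: pos_less_divide_eq mult.commute)
    show "\<exists>M. \<forall>m\<ge>M. \<forall>n\<ge>M. dist (re_part (X m)) (re_part (X n)) < e"
      using le_less_trans[OF part(1) small] by (auto simp: dist_norm minus_complexification_def)
    show "\<exists>M. \<forall>m\<ge>M. \<forall>n\<ge>M. dist (im_part (X m)) (im_part (X n)) < e"
      using le_less_trans[OF part(2) small] by (auto simp: dist_norm minus_complexification_def)
  qed
  then obtain a b where "(\<lambda>n. re_part (X n)) \<longlonglongrightarrow> a" "(\<lambda>n. im_part (X n)) \<longlonglongrightarrow> b"
    by (meson Cauchy_convergent convergentD)
  then show ?thesis by (intro exI[of _ "Cplx a b"]) (simp add: tends_C_def)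
qed

lemma countable_dense_C:
  obtains C :: "'a complexification set" where "countable C"
    "\<And>x \<epsilon>. \<epsilon> > 0 \<Longrightarrow> \<exists>q\<in>C. norm_C g (x - q) < \<epsilon>"
proof -
  obtain D :: "'a set" where D: "countable D" "closure D = UNIV"
    using separable unfolding separable_space_def by auto
  obtain c where c: "c > 0" "\<And>v. sqrt (g v v) \<le> c * norm v" by (rule g_norm_equiv) blast
  define C where "C = (\<lambda>(a, b). Cplx a b) ` (D \<times> D)"
  have "countable C" unfolding C_def using D by blast
  moreover have "\<exists>q\<in>C. norm_C g (x - q) < \<epsilon>" if e: "\<epsilon> > 0" for x \<epsilon>
  proof -
    have d: "\<epsilon> / (2 * c) > 0" using e c by simp
    then obtain a b where ab: "a \<in> D" "b \<in> D" "dist a (re_part x) < \<epsilon> / (2 * c)" "dist b (im_part x) < \<epsilon> / (2 * c)"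
      using D(2) by (metis UNIV_I closure_approachable)
    define u where "u = re_part x - a" define v where "v = im_part x - b"
    have uv: "c * norm u < \<epsilon> / 2" "c * norm v < \<epsilon> / 2"
      using ab c(1) unfolding u_def v_def by (simp_all add: dist_norm norm_minus_commute field_simps)
    have "norm_C g (x - Cplx a b) = sqrt (g u u + g v v)"
      by (simp add: ip_norm_def sesq_C_def u_def v_def minus_complexification_def)
    also have "\<dots> \<le> sqrt (g u u) + sqrt (g v v)" using g_nonneg by (simp add: sqrt_add_le_add_sqrt)
    also have "\<dots> < \<epsilon>" using c(2)[of u] c(2)[of v] uv by linarith
    finally show ?thesis using ab unfolding C_def by force
  qed
  ultimately show ?thesis using that by blast
qed

text \<open>
  A complex-linear functional is determined by its values on the real subspace; there its real and
  imaginary parts have Riesz vectors \<open>p\<close> and \<open>q\<close>, and sesquilinearity makes \<open>p - \<i> q\<close> the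
  representing vector.
\<close>

lemma riesz_complex:
  assumes add: "\<And>x y. f (x + y) = f x + f y" and scale: "\<And>c x. f (c *\<^sub>C x) = c * f x"
    and bound: "\<And>x. cmod (f x) \<le> K * norm_C g x"
  shows "\<exists>z. \<forall>x. f x = sesq_C g x z"
proof -
  obtain c where c: "c > 0" "\<And>v. sqrt (g v v) \<le> c * norm v" by (rule g_norm_equiv) blast
  let ?\<iota> = "\<lambda>v. Cplx v 0"
  have nonneg: "0 \<le> K * norm_C g x" for x using bound[of x] norm_ge_zero order_trans by blast
  have real: "f (?\<iota> (v + w)) = f (?\<iota> v) + f (?\<iota> w)" "f (?\<iota> (r *\<^sub>R v)) = of_real r * f (?\<iota> v)"
    for v w and r :: real
    using add[of "?\<iota> v" "?\<iota> w"] scale[of "of_real r" "?\<iota> v"] by (simp_all add: complexification_simps)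
  have b: "cmod (f (?\<iota> v)) \<le> norm v * (\<bar>K\<bar> * c)" for v
  proof -
    have "cmod (f (?\<iota> v)) \<le> \<bar>K\<bar> * norm_C g (?\<iota> v)"
      using bound[of "?\<iota> v"] norm_nonneg[of "?\<iota> v"] by (smt (verit) mult_right_mono)
    also have "\<dots> \<le> \<bar>K\<bar> * (c * norm v)"
      using c(2)[of v] by (intro mult_left_mono) (simp_all add: ip_norm_def sesq_C_def g_simps)
    finally show ?thesis by (simp add: mult_ac)
  qed
  have "bounded_linear (\<lambda>v. Re (f (?\<iota> v)))" "bounded_linear (\<lambda>v. Im (f (?\<iota> v)))"
    by (rule bounded_linear_intro[where K="\<bar>K\<bar> * c"];
        simp add: real order_trans[OF abs_Re_le_cmod b] order_trans[OF abs_Im_le_cmod b])+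
  note bounded = this
  obtain p where p: "\<And>w. g p w = Re (f (?\<iota> w))" using riesz_real[OF bounded(1)] by auto
  obtain q where q: "\<And>w. g q w = Im (f (?\<iota> w))" using riesz_real[OF bounded(2)] by auto
  have rep: "f (?\<iota> v) = sesq_C g (?\<iota> v) (Cplx p (- q))" for v
    using p[of v] q[of v] g_sym[of v p] g_sym[of v q] by (simp add: sesq_C_def g_simps complex_eq_iff)
  have "f x = sesq_C g x (Cplx p (- q))" for x
  proof -
    have x: "x = ?\<iota> (re_part x) + \<i> *\<^sub>C ?\<iota> (im_part x)" by (simp add: complexification_simps)
    have "f x = f (?\<iota> (re_part x)) + \<i> * f (?\<iota> (im_part x))" by (subst x) (simp add: add scale)
    also have "\<dots> = sesq_C g (?\<iota> (re_part x) + \<i> *\<^sub>C ?\<iota> (im_part x)) (Cplx p (- q))"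
      unfolding rep by (simp only: H_simps)
    finally show ?thesis using x by simp
  qed
  then show ?thesis by blast
qed

section \<open>Adjoints and the symmetry condition\<close>

abbreviation Lp where "Lp \<equiv> L_plus J"
abbreviation Lm where "Lm \<equiv> L_minus J"

lemma ext_C_linear: "ext_C J (x + y) = ext_C J x + ext_C J y" "ext_C J (c *\<^sub>C x) = c *\<^sub>C ext_C J x"
  by (simp_all add: ext_C_def complexification_simps J_simps)

lemma subspace_Lp: "complex_vector.subspace Lp" and subspace_Lm: "complex_vector.subspace Lm"
  unfolding complex_vector.subspace_def L_plus_def L_minus_def
  by (auto simp: ext_C_linear complexification_simps ext_C_def J_simps algebra_simps
      simp flip: scaleR_add_right)

lemmas Lp_mem = complex_vector.subspace_0[OF subspace_Lp] complex_vector.subspace_add[OF subspace_Lp]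
  complex_vector.subspace_diff[OF subspace_Lp] complex_vector.subspace_scale[OF subspace_Lp]
lemmas Lm_mem = complex_vector.subspace_0[OF subspace_Lm] complex_vector.subspace_add[OF subspace_Lm]
  complex_vector.subspace_diff[OF subspace_Lm] complex_vector.subspace_scale[OF subspace_Lm]

lemma conj_C_mem [simp]: "conj_C x \<in> Lm \<longleftrightarrow> x \<in> Lp" "conj_C x \<in> Lp \<longleftrightarrow> x \<in> Lm"
  unfolding L_plus_def L_minus_def
  by (auto simp: ext_C_def conj_C_def complexification_simps J_simps add_eq_0_iff)

text \<open>
  The orthogonal projection onto \<open>L\<^sup>+\<close>. It extends operators on \<open>L\<^sup>+\<close> to the whole space, where
  functionals have representing vectors, and brings these vectors back to \<open>L\<^sup>+\<close>.
\<close>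

definition proj_plus :: "'a complexification \<Rightarrow> 'a complexification" where
  "proj_plus x = (1/2) *\<^sub>C (x - \<i> *\<^sub>C ext_C J x)"

lemma proj_plus_mem: "proj_plus x \<in> Lp"
  unfolding L_plus_def proj_plus_def
  by (simp add: ext_C_def complexification_simps J_simps J_J algebra_simps)

lemma proj_plus_id: "x \<in> Lp \<Longrightarrow> proj_plus x = x"
proof -
  assume "x \<in> Lp"
  then have "ext_C J x = \<i> *\<^sub>C x" by (simp add: L_plus_def)
  then have "proj_plus x = (1/2) *\<^sub>C (x + x)" unfolding proj_plus_def by (simp add: scaleC_scaleC)
  also have "\<dots> = x" by (simp add: scaleC_add_right complex_vector.scale_left_distrib[symmetric] scaleC_one)
  finally show ?thesis .
qed

lemma proj_plus_linear: "proj_plus (x + y) = proj_plus x + proj_plus y"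
  "proj_plus (c *\<^sub>C x) = c *\<^sub>C proj_plus x"
  unfolding proj_plus_def
  by (simp_all add: ext_C_linear scaleC_add_right complex_vector.scale_right_diff_distrib scaleC_scaleC mult_ac)

lemma sesq_proj_plus: "sesq_C g (proj_plus x) y = sesq_C g x (proj_plus y)"
proof -
  have "sesq_C g (ext_C J x) y = - sesq_C g x (ext_C J y)"
    by (simp add: sesq_C_def ext_C_def g_J complex_eq_iff)
  then show ?thesis by (simp add: proj_plus_def H_simps)
qed

lemma norm_proj_plus: "norm_C g (proj_plus x) \<le> norm_C g x"
proof -
  let ?p = "proj_plus x"
  have "(norm_C g ?p)\<^sup>2 = Re (sesq_C g x ?p)"
    by (simp add: H.nrm_sq sesq_proj_plus proj_plus_id proj_plus_mem)
  also have "\<dots> \<le> norm_C g x * norm_C g ?p"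
    using H.cauchy_schwarz[of x ?p] complex_Re_le_cmod order_trans by blast
  finally show ?thesis using norm_nonneg[of x] norm_nonneg[of ?p]
    by (cases "norm_C g ?p = 0") (auto simp: power2_eq_square)
qed

abbreviation \<B> where "\<B> \<equiv> bounded_ops_C g Lp Lm"

lemma
  assumes "Z \<in> \<B>"
  shows op_mem: "x \<in> Lp \<Longrightarrow> Z x \<in> Lm"
    and op_outside: "x \<notin> Lp \<Longrightarrow> Z x = 0"
    and op_add: "x \<in> Lp \<Longrightarrow> y \<in> Lp \<Longrightarrow> Z (x + y) = Z x + Z y"
    and op_scale: "x \<in> Lp \<Longrightarrow> Z (c *\<^sub>C x) = c *\<^sub>C Z x"
  using assms unfolding bounded_ops_def by blast+

lemma opI:
  assumes "\<And>x. x \<in> Lp \<Longrightarrow> Z x \<in> Lm" "\<And>x. x \<notin> Lp \<Longrightarrow> Z x = 0"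
    "\<And>x y. x \<in> Lp \<Longrightarrow> y \<in> Lp \<Longrightarrow> Z (x + y) = Z x + Z y"
    "\<And>c x. x \<in> Lp \<Longrightarrow> Z (c *\<^sub>C x) = c *\<^sub>C Z x"
    "\<And>x. x \<in> Lp \<Longrightarrow> norm_C g (Z x) \<le> K * norm_C g x"
  shows "Z \<in> \<B>"
  using assms unfolding bounded_ops_def by blast

lemma op_bounded:
  assumes "Z \<in> \<B>"
  obtains K where "K \<ge> 0" "\<And>x. x \<in> Lp \<Longrightarrow> norm_C g (Z x) \<le> K * norm_C g x"
proof -
  obtain K where K: "\<And>x. x \<in> Lp \<Longrightarrow> norm_C g (Z x) \<le> K * norm_C g x"
    using assms unfolding bounded_ops_def by blast
  have "norm_C g (Z x) \<le> \<bar>K\<bar> * norm_C g x" if "x \<in> Lp" for x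
    using K[OF that] mult_right_mono[OF abs_ge_self[of K] norm_nonneg[of x]] by linarith
  then show ?thesis using that[of "\<bar>K\<bar>"] by simp
qed

text \<open>
  For \<open>y \<in> L\<^sup>-\<close> the functional \<open>x \<mapsto> g(Z P x, y)\<close> with the projection \<open>P\<close> onto \<open>L\<^sup>+\<close> is bounded; the
  projection of its Riesz vector is the value of the adjoint at \<open>y\<close>.
\<close>

lemma adjoint_ex1:
  assumes Z: "Z \<in> \<B>"
  shows "\<exists>!S. S \<in> bounded_ops_C g Lm Lp \<and> (\<forall>x\<in>Lp. \<forall>y\<in>Lm. sesq_C g (Z x) y = sesq_C g x (S y))"
proof -
  obtain K where K: "K \<ge> 0" "\<And>x. x \<in> Lp \<Longrightarrow> norm_C g (Z x) \<le> K * norm_C g x"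
    using op_bounded[OF Z] by blast
  have "\<exists>z. \<forall>x. sesq_C g (Z (proj_plus x)) y = sesq_C g x z" for y
  proof (rule riesz_complex)
    show "sesq_C g (Z (proj_plus (x + x'))) y = sesq_C g (Z (proj_plus x)) y + sesq_C g (Z (proj_plus x')) y" for x x'
      by (simp add: proj_plus_linear op_add[OF Z] proj_plus_mem H_simps)
    show "sesq_C g (Z (proj_plus (c *\<^sub>C x))) y = c * sesq_C g (Z (proj_plus x)) y" for c x
      by (simp add: proj_plus_linear op_scale[OF Z] proj_plus_mem H_simps)
    show "cmod (sesq_C g (Z (proj_plus x)) y) \<le> (K * norm_C g y) * norm_C g x" for x
    proof -
      have "cmod (sesq_C g (Z (proj_plus x)) y) \<le> norm_C g (Z (proj_plus x)) * norm_C g y"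
        by (simp add: H.cauchy_schwarz)
      also have "\<dots> \<le> (K * norm_C g (proj_plus x)) * norm_C g y"
        by (intro mult_right_mono K proj_plus_mem norm_nonneg)
      also have "\<dots> \<le> (K * norm_C g x) * norm_C g y"
        by (intro mult_right_mono mult_left_mono K norm_nonneg norm_proj_plus)
      finally show ?thesis by (simp add: mult_ac)
    qed
  qed
  then obtain R where R: "\<And>x y. sesq_C g (Z (proj_plus x)) y = sesq_C g x (R y)" by metis
  define S where "S = (\<lambda>y. if y \<in> Lm then proj_plus (R y) else 0)"
  have S: "sesq_C g (Z x) y = sesq_C g x (S y)" if "x \<in> Lp" "y \<in> Lm" for x y
    using R[of x y] that by (simp add: S_def sesq_proj_plus[symmetric] proj_plus_id)
  have S_mem: "S y \<in> Lp" for y unfolding S_def by (simp add: proj_plus_mem Lp_mem)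
  have eqI: "u = v" if "u \<in> Lp" "v \<in> Lp" "\<And>x. x \<in> Lp \<Longrightarrow> sesq_C g x u = sesq_C g x v" for u v
  proof -
    have "sesq_C g (u - v) (u - v) = 0" using that(3)[of "u - v"] that Lp_mem by (simp add: H_simps)
    then have "norm_C g (u - v) = 0" by (simp add: ip_norm_def)
    then show ?thesis using norm_eq_0_iff by simp
  qed
  have "S \<in> bounded_ops_C g Lm Lp"
    unfolding bounded_ops_def
  proof (intro CollectI conjI ballI allI impI exI[of _ K] image_subsetI)
    show "S x = 0" if "x \<notin> Lm" for x using that by (simp add: S_def)
    show "S (x + y) = S x + S y" if "x \<in> Lm" "y \<in> Lm" for x y
      by (rule eqI) (simp_all add: S_mem Lp_mem Lm_mem H_simps that flip: S)
    show "S (c *\<^sub>C x) = c *\<^sub>C S x" if "x \<in> Lm" for c x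
      by (rule eqI) (simp_all add: S_mem Lp_mem Lm_mem H_simps that flip: S)
    show "norm_C g (S y) \<le> K * norm_C g y" if y: "y \<in> Lm" for y
    proof -
      have "(norm_C g (S y))\<^sup>2 = Re (sesq_C g (Z (S y)) y)" by (simp add: H.nrm_sq S[OF S_mem y])
      also have "\<dots> \<le> norm_C g (Z (S y)) * norm_C g y"
        using H.cauchy_schwarz[of "Z (S y)" y] complex_Re_le_cmod order_trans by blast
      also have "\<dots> \<le> (K * norm_C g (S y)) * norm_C g y"
        by (intro mult_right_mono K S_mem norm_nonneg)
      finally have "norm_C g (S y) * norm_C g (S y) \<le> (K * norm_C g y) * norm_C g (S y)"
        by (simp add: power2_eq_square mult_ac)
      then show ?thesis using norm_nonneg[of "S y"] norm_nonneg[of y] K(1)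
        by (cases "norm_C g (S y) = 0") auto
    qed
  qed (rule S_mem)
  moreover have "T = S" if T: "T \<in> bounded_ops_C g Lm Lp"
    "\<forall>x\<in>Lp. \<forall>y\<in>Lm. sesq_C g (Z x) y = sesq_C g x (T y)" for T
  proof
    fix y
    show "T y = S y"
    proof (cases "y \<in> Lm")
      case True
      then have "T y \<in> Lp" using T(1) unfolding bounded_ops_def by blast
      then show ?thesis using T(2) True S by (intro eqI[OF _ S_mem]) auto
    next
      case False
      then show ?thesis using T(1) by (simp add: S_def bounded_ops_def)
    qed
  qed
  ultimately show ?thesis using S by blast
qed

abbreviation adj where "adj \<equiv> adjoint_C g Lp Lm"

lemma sesq_adjoint: "Z \<in> \<B> \<Longrightarrow> x \<in> Lp \<Longrightarrow> y \<in> Lm \<Longrightarrow> sesq_C g (Z x) y = sesq_C g x (adj Z y)"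
  unfolding adjoint_C_def using theI'[OF adjoint_ex1] by blast

text \<open>
  The condition \<open>\<alpha> Z \<alpha> = Z\<^sup>*\<close> says that the complex-bilinear form \<open>(x, y) \<mapsto> g(Z x, \<alpha> y)\<close> on
  \<open>L\<^sup>+\<close> is symmetric.
\<close>

definition symmetric_form :: "('a complexification \<Rightarrow> 'a complexification) \<Rightarrow> bool" where
  "symmetric_form Z \<longleftrightarrow> (\<forall>x\<in>Lp. \<forall>y\<in>Lp. sesq_C g (Z x) (conj_C y) = sesq_C g (Z y) (conj_C x))"

lemma sesq_conj_swap: "sesq_C g x (conj_C y) = sesq_C g y (conj_C x)"
proof -
  have "cnj (sesq_C g x (conj_C y)) = sesq_C g (conj_C x) y" using sesq_conj[of x "conj_C y"] by simp
  also have "\<dots> = cnj (sesq_C g y (conj_C x))" by (rule H.hermitian) simp_all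
  finally show ?thesis by simp
qed

lemma conj_eq_adjoint_iff:
  assumes Z: "Z \<in> \<B>"
  shows "conj_C \<circ> Z \<circ> conj_C = adj Z \<longleftrightarrow> symmetric_form Z"
proof
  assume eq: "conj_C \<circ> Z \<circ> conj_C = adj Z"
  show "symmetric_form Z" unfolding symmetric_form_def
  proof (intro ballI)
    fix x y assume xy: "x \<in> Lp" "y \<in> Lp"
    have "sesq_C g (Z x) (conj_C y) = sesq_C g x (adj Z (conj_C y))"
      using xy by (simp add: sesq_adjoint[OF Z])
    also have "adj Z (conj_C y) = conj_C (Z y)" by (simp flip: eq)
    also have "sesq_C g x (conj_C (Z y)) = sesq_C g (Z y) (conj_C x)" by (rule sesq_conj_swap)
    finally show "sesq_C g (Z x) (conj_C y) = sesq_C g (Z y) (conj_C x)" .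
  qed
next
  assume sym: "symmetric_form Z"
  have "conj_C \<circ> Z \<circ> conj_C \<in> bounded_ops_C g Lm Lp"
    unfolding bounded_ops_def
  proof (intro CollectI conjI ballI allI impI image_subsetI)
    show "(conj_C \<circ> Z \<circ> conj_C) x \<in> Lp" if "x \<in> Lm" for x
      using that op_mem[OF Z] by simp
    show "(conj_C \<circ> Z \<circ> conj_C) x = 0" if "x \<notin> Lm" for x
      using that op_outside[OF Z] by simp
    show "(conj_C \<circ> Z \<circ> conj_C) (x + y) = (conj_C \<circ> Z \<circ> conj_C) x + (conj_C \<circ> Z \<circ> conj_C) y"
      if "x \<in> Lm" "y \<in> Lm" for x y
      using that op_add[OF Z] by (simp add: conj_C_add)
    show "(conj_C \<circ> Z \<circ> conj_C) (c *\<^sub>C x) = c *\<^sub>C (conj_C \<circ> Z \<circ> conj_C) x" if "x \<in> Lm" for c x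
      using that op_scale[OF Z] by (simp add: conj_C_scale)
    obtain K where K: "\<And>x. x \<in> Lp \<Longrightarrow> norm_C g (Z x) \<le> K * norm_C g x"
      using op_bounded[OF Z] by blast
    have "norm_C g ((conj_C \<circ> Z \<circ> conj_C) x) \<le> K * norm_C g x" if "x \<in> Lm" for x
      using that K[of "conj_C x"] by simp
    then show "\<exists>K. \<forall>x\<in>Lm. norm_C g ((conj_C \<circ> Z \<circ> conj_C) x) \<le> K * norm_C g x" by blast
  qed
  moreover have "sesq_C g (Z x) y = sesq_C g x ((conj_C \<circ> Z \<circ> conj_C) y)" if "x \<in> Lp" "y \<in> Lm" for x y
  proof -
    have "sesq_C g (Z x) (conj_C (conj_C y)) = sesq_C g (Z (conj_C y)) (conj_C x)"
      using sym that unfolding symmetric_form_def by (metis conj_C_mem(2))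
    then show ?thesis using sesq_conj_swap[of x "Z (conj_C y)"] by simp
  qed
  ultimately show "conj_C \<circ> Z \<circ> conj_C = adj Z"
    unfolding adjoint_C_def by (intro the1_equality[OF adjoint_ex1[OF Z], symmetric]) blast
qed

section \<open>The Banach space of symmetric operators\<close>

abbreviation \<S> where "\<S> \<equiv> symmetric_ops g J"
abbreviation opn where "opn \<equiv> op_norm_L g J"

lemma symmetric_ops_eq: "\<S> = {Z \<in> \<B>. symmetric_form Z}"
  unfolding symmetric_ops_def using conj_eq_adjoint_iff by blast

lemma subspace_bounded_ops: "complex_vector.subspace \<B>"
  unfolding complex_vector.subspace_def
proof (intro conjI ballI allI)
  show "0 \<in> \<B>" by (rule opI[where K=0]) (simp_all add: Lm_mem)
next
  fix Z W assume Z: "Z \<in> \<B>" and W: "W \<in> \<B>"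
  obtain K where K: "\<And>x. x \<in> Lp \<Longrightarrow> norm_C g (Z x) \<le> K * norm_C g x" using op_bounded[OF Z] by blast
  obtain M where M: "\<And>x. x \<in> Lp \<Longrightarrow> norm_C g (W x) \<le> M * norm_C g x" using op_bounded[OF W] by blast
  have "norm_C g ((Z + W) x) \<le> (K + M) * norm_C g x" if "x \<in> Lp" for x
    using norm_triangle[of "Z x" "W x"] K[OF that] M[OF that] by (simp add: algebra_simps)
  then show "Z + W \<in> \<B>"
    by (intro opI[where K="K + M"])
      (simp_all add: Lm_mem op_mem[OF Z] op_mem[OF W] op_outside[OF Z] op_outside[OF W]
      op_add[OF Z] op_add[OF W] op_scale[OF Z] op_scale[OF W] scaleC_add_right)
next
  fix c Z assume Z: "Z \<in> \<B>"
  obtain K where K: "\<And>x. x \<in> Lp \<Longrightarrow> norm_C g (Z x) \<le> K * norm_C g x" using op_bounded[OF Z] by blast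
  have "norm_C g ((c *\<^sub>C Z) x) \<le> (cmod c * K) * norm_C g x" if "x \<in> Lp" for x
    using mult_left_mono[OF K[OF that], of "cmod c"] by (simp add: scaleC_fun_def norm_scale mult_ac)
  then show "c *\<^sub>C Z \<in> \<B>"
    by (intro opI[where K="cmod c * K"])
      (simp_all add: Lm_mem op_mem[OF Z] op_outside[OF Z] op_add[OF Z] op_scale[OF Z]
      scaleC_fun_def scaleC_add_right scaleC_scaleC mult.commute)
qed

lemma subspace_symmetric_ops: "complex_vector.subspace \<S>"
  using subspace_bounded_ops
  unfolding complex_vector.subspace_def symmetric_ops_eq symmetric_form_def
  by (simp add: H_simps scaleC_fun_def)

lemmas S_mem = complex_vector.subspace_0[OF subspace_symmetric_ops]
  complex_vector.subspace_add[OF subspace_symmetric_ops]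
  complex_vector.subspace_diff[OF subspace_symmetric_ops]
  complex_vector.subspace_scale[OF subspace_symmetric_ops]

lemma S_B: "Z \<in> \<S> \<Longrightarrow> Z \<in> \<B>" and S_sym: "Z \<in> \<S> \<Longrightarrow> symmetric_form Z"
  unfolding symmetric_ops_eq by auto

lemma
  assumes Z: "Z \<in> \<B>"
  shows norm_le_op_norm: "x \<in> Lp \<Longrightarrow> norm_C g (Z x) \<le> opn Z * norm_C g x"
    and op_norm_nonneg: "0 \<le> opn Z"
proof -
  obtain K where K: "K \<ge> 0" "\<And>x. x \<in> Lp \<Longrightarrow> norm_C g (Z x) \<le> K * norm_C g x"
    using op_bounded[OF Z] by blast
  have bdd: "bdd_above ((\<lambda>x. norm_C g (Z x)) ` {x \<in> Lp. norm_C g x \<le> 1})"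
  proof (rule bdd_aboveI2)
    fix x assume "x \<in> {x \<in> Lp. norm_C g x \<le> 1}"
    then show "norm_C g (Z x) \<le> K" using K(2)[of x] mult_left_le[of "norm_C g x" K] K(1) by simp
  qed
  have le: "norm_C g (Z x) \<le> opn Z" if "x \<in> Lp" "norm_C g x \<le> 1" for x
    unfolding op_norm_L_def op_norm_def using that by (intro cSUP_upper bdd) simp
  show "0 \<le> opn Z"
    using le[of 0] norm_nonneg[of "Z 0"] Lp_mem(1) by simp
  show "norm_C g (Z x) \<le> opn Z * norm_C g x" if x: "x \<in> Lp"
  proof (cases "x = 0")
    case True
    then show ?thesis using K(2)[OF x] by simp
  next
    case False
    then have n: "norm_C g x > 0" using norm_eq_0_iff[of x] norm_nonneg[of x] by simp
    let ?y = "complex_of_real (1 / norm_C g x) *\<^sub>C x"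
    have "norm_C g (Z ?y) \<le> opn Z"
      using n x by (intro le) (simp_all add: Lp_mem norm_scale norm_divide)
    moreover have "norm_C g (Z ?y) = norm_C g (Z x) / norm_C g x"
      using n x by (simp add: op_scale[OF Z] norm_scale norm_divide)
    ultimately have "norm_C g (Z x) / norm_C g x \<le> opn Z" by simp
    then show ?thesis using n by (simp add: pos_divide_le_eq)
  qed
qed

lemma op_norm_le:
  assumes "K \<ge> 0" "\<And>x. x \<in> Lp \<Longrightarrow> norm_C g (Z x) \<le> K * norm_C g x"
  shows "opn Z \<le> K"
  unfolding op_norm_L_def op_norm_def
proof (rule cSUP_least)
  show "{x \<in> Lp. norm_C g x \<le> 1} \<noteq> {}" using Lp_mem(1) by force
  fix x assume "x \<in> {x \<in> Lp. norm_C g x \<le> 1}"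
  then show "norm_C g (Z x) \<le> K" using assms(2)[of x] mult_left_le[of "norm_C g x" K] assms(1) by simp
qed

lemma normed_space_symmetric_ops: "complex_normed_space \<S> opn"
  unfolding complex_normed_space_def
proof (intro conjI ballI allI)
  fix Z assume Z: "Z \<in> \<S>"
  note ZB = S_B[OF Z]
  show "0 \<le> opn Z" by (rule op_norm_nonneg[OF ZB])
  show "opn Z = 0 \<longleftrightarrow> Z = 0"
  proof
    assume 0: "opn Z = 0"
    show "Z = 0"
    proof
      fix x
      have "norm_C g (Z x) \<le> 0" if "x \<in> Lp" using norm_le_op_norm[OF ZB that] 0 by simp
      then show "Z x = 0 x"
        using norm_nonneg[of "Z x"] norm_eq_0_iff op_outside[OF ZB] by (cases "x \<in> Lp") auto
    qed
  next
    assume "Z = 0"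
    then have "opn Z \<le> 0" by (intro op_norm_le) auto
    then show "opn Z = 0" using op_norm_nonneg[OF ZB] by simp
  qed
  show scale: "opn (c *\<^sub>C Z) = cmod c * opn Z" for c
  proof (cases "c = 0")
    case True
    have "opn (c *\<^sub>C Z) \<le> 0"
      using True by (intro op_norm_le) auto
    then show ?thesis using True op_norm_nonneg[OF S_B[OF S_mem(4)[OF Z]], of c] by simp
  next
    case False
    have le: "opn (c *\<^sub>C Z) \<le> cmod c * opn Z"
      using norm_le_op_norm[OF ZB] op_norm_nonneg[OF ZB]
      by (intro op_norm_le) (auto simp: scaleC_fun_def norm_scale mult.assoc intro!: mult_left_mono)
    have "norm_C g (Z x) \<le> (opn (c *\<^sub>C Z) / cmod c) * norm_C g x" if "x \<in> Lp" for x
      using norm_le_op_norm[OF S_B[OF S_mem(4)[OF Z]] that, of c] False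
      by (simp add: scaleC_fun_def norm_scale field_simps)
    then have "opn Z \<le> opn (c *\<^sub>C Z) / cmod c"
      using op_norm_nonneg[OF S_B[OF S_mem(4)[OF Z]], of c] by (intro op_norm_le) auto
    then show ?thesis using le False by (simp add: field_simps)
  qed
  fix W assume W: "W \<in> \<S>"
  note WB = S_B[OF W]
  show "opn (Z + W) \<le> opn Z + opn W"
  proof (rule op_norm_le)
    show "0 \<le> opn Z + opn W" using op_norm_nonneg[OF ZB] op_norm_nonneg[OF WB] by simp
    show "norm_C g ((Z + W) x) \<le> (opn Z + opn W) * norm_C g x" if "x \<in> Lp" for x
      using norm_triangle[of "Z x" "W x"] norm_le_op_norm[OF ZB that] norm_le_op_norm[OF WB that]
      by (simp add: algebra_simps)
  qed
qed (rule subspace_symmetric_ops)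

text \<open>
  The pointwise limit is stated along with the limit in operator norm because the
  Hilbert-Schmidt norm is a sum of values at vectors.
\<close>

lemma symmetric_ops_pointwise_limit:
  assumes X: "\<And>n. X n \<in> \<S>"
    and cauchy: "\<And>\<epsilon>. \<epsilon> > 0 \<Longrightarrow> \<exists>k. \<forall>m\<ge>k. \<forall>n\<ge>k. opn (X m - X n) < \<epsilon>"
  obtains Z where "Z \<in> \<S>" "\<And>x. tends_C (\<lambda>n. X n x) (Z x)"
    "\<And>\<epsilon>. \<epsilon> > 0 \<Longrightarrow> \<exists>k. \<forall>n\<ge>k. opn (X n - Z) < \<epsilon>"
proof -
  note XB = S_B[OF X]
  have diff: "norm_C g (X m x - X n x) \<le> opn (X m - X n) * norm_C g x" if "x \<in> Lp" for m n x
    using norm_le_op_norm[OF S_B[OF S_mem(3)[OF X X]] that, of m n] by simp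
  have "\<exists>z. tends_C (\<lambda>n. X n x) z" for x
  proof (cases "x \<in> Lp")
    case True
    show ?thesis
    proof (rule norm_C_convergent)
      fix \<epsilon> :: real assume e: "\<epsilon> > 0"
      have p: "norm_C g x + 1 > 0" using norm_nonneg[of x] by simp
      then obtain k where k: "\<forall>m\<ge>k. \<forall>n\<ge>k. opn (X m - X n) < \<epsilon> / (norm_C g x + 1)"
        using cauchy[of "\<epsilon> / (norm_C g x + 1)"] e by auto
      have "norm_C g (X m x - X n x) < \<epsilon>" if "m \<ge> k" "n \<ge> k" for m n
      proof -
        have "opn (X m - X n) * norm_C g x \<le> \<epsilon> / (norm_C g x + 1) * norm_C g x"
          using k that by (intro mult_right_mono norm_nonneg less_imp_le) simp
        also have "\<dots> < \<epsilon>" using p e by (simp add: field_simps)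
        finally show ?thesis using diff[OF True, of m n] by simp
      qed
      then show "\<exists>k. \<forall>m\<ge>k. \<forall>n\<ge>k. norm_C g (X m x - X n x) < \<epsilon>" by blast
    qed
  next
    case False
    then have "(\<lambda>n. X n x) = (\<lambda>n. 0)" using op_outside[OF XB] by simp
    then show ?thesis using tends_C_const by metis
  qed
  then obtain Z where lim: "\<And>x. tends_C (\<lambda>n. X n x) (Z x)" by metis
  have close: "norm_C g (X n x - Z x) \<le> \<epsilon> * norm_C g x"
    if k: "\<forall>m\<ge>k. \<forall>n\<ge>k. opn (X m - X n) < \<epsilon>" and n: "n \<ge> k" and x: "x \<in> Lp" for n k x \<epsilon>
  proof (rule LIMSEQ_le_const2)
    show "(\<lambda>m. norm_C g (X n x - X m x)) \<longlonglongrightarrow> norm_C g (X n x - Z x)"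
      by (rule tends_C_norm[OF bilinear_g tends_C_diff[OF tends_C_const lim]])
    have "norm_C g (X n x - X m x) \<le> \<epsilon> * norm_C g x" if "m \<ge> k" for m
      using diff[OF x, of n m] mult_right_mono[OF less_imp_le norm_nonneg[of x], of "opn (X n - X m)" \<epsilon>]
        k n that by fastforce
    then show "\<exists>N. \<forall>m\<ge>N. norm_C g (X n x - X m x) \<le> \<epsilon> * norm_C g x" by blast
  qed
  obtain k where k: "\<forall>m\<ge>k. \<forall>n\<ge>k. opn (X m - X n) < 1" using cauchy[of 1] by auto
  have "Z \<in> \<B>"
  proof (rule opI[where K="opn (X k) + 1"])
    show "Z x \<in> Lm" if x: "x \<in> Lp" for x
    proof -
      have "tends_C (\<lambda>n. ext_C J (X n x) + \<i> *\<^sub>C X n x) (ext_C J (Z x) + \<i> *\<^sub>C Z x)"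
        by (intro tends_C_add tends_C_ext[OF J_bounded] tends_C_scale lim)
      moreover have "ext_C J (X n x) + \<i> *\<^sub>C X n x = 0" for n
        using op_mem[OF XB x, of n] by (simp add: L_minus_def)
      ultimately have "ext_C J (Z x) + \<i> *\<^sub>C Z x = 0"
        using tends_C_unique[OF _ tends_C_const] by simp
      then show ?thesis by (simp add: L_minus_def)
    qed
    show "Z x = 0" if "x \<notin> Lp" for x
      using tends_C_unique[OF lim[of x], of 0] op_outside[OF XB that] by (simp add: tends_C_const)
    show "Z (x + y) = Z x + Z y" if "x \<in> Lp" "y \<in> Lp" for x y
      using tends_C_unique[OF lim[of "x + y"] tends_C_add[OF lim[of x] lim[of y], folded op_add[OF XB that]]] .
    show "Z (c *\<^sub>C x) = c *\<^sub>C Z x" if "x \<in> Lp" for c x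
      using tends_C_unique[OF lim[of "c *\<^sub>C x"] tends_C_scale[OF lim[of x], of c, folded op_scale[OF XB that]]] .
    show "norm_C g (Z x) \<le> (opn (X k) + 1) * norm_C g x" if x: "x \<in> Lp" for x
    proof -
      have "norm_C g (Z x) \<le> norm_C g (X k x) + norm_C g (Z x - X k x)"
        using norm_triangle[of "X k x" "Z x - X k x"] by simp
      also have "\<dots> \<le> opn (X k) * norm_C g x + 1 * norm_C g x"
        using close[OF k order_refl x] norm_le_op_norm[OF XB x, of k] norm_diff_commute[of "Z x" "X k x"] by simp
      finally show ?thesis by (simp add: algebra_simps)
    qed
  qed
  moreover have "symmetric_form Z" unfolding symmetric_form_def
  proof (intro ballI)
    fix x y assume xy: "x \<in> Lp" "y \<in> Lp"
    have "(\<lambda>n. sesq_C g (X n x) (conj_C y)) \<longlonglongrightarrow> sesq_C g (Z x) (conj_C y)"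
      by (rule tends_C_sesq[OF bilinear_g lim tends_C_const])
    moreover have "(\<lambda>n. sesq_C g (X n y) (conj_C x)) \<longlonglongrightarrow> sesq_C g (Z y) (conj_C x)"
      by (rule tends_C_sesq[OF bilinear_g lim tends_C_const])
    moreover have "sesq_C g (X n x) (conj_C y) = sesq_C g (X n y) (conj_C x)" for n
      using S_sym[OF X, of n] xy unfolding symmetric_form_def by blast
    ultimately show "sesq_C g (Z x) (conj_C y) = sesq_C g (Z y) (conj_C x)"
      using LIMSEQ_unique by simp
  qed
  ultimately have Z: "Z \<in> \<S>" unfolding symmetric_ops_eq by blast
  have "\<exists>k. \<forall>n\<ge>k. opn (X n - Z) < \<epsilon>" if e: "\<epsilon> > 0" for \<epsilon>
  proof -
    obtain k where k: "\<forall>m\<ge>k. \<forall>n\<ge>k. opn (X m - X n) < \<epsilon> / 2" using cauchy[of "\<epsilon> / 2"] e by auto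
    have "opn (X n - Z) \<le> \<epsilon> / 2" if "n \<ge> k" for n
      using close[OF k that] e by (intro op_norm_le) auto
    then show ?thesis using e by (intro exI[of _ k]) fastforce
  qed
  then show ?thesis using that[OF Z lim] by blast
qed

lemma banach_space_symmetric_ops: "complex_banach_space \<S> opn"
  unfolding complex_banach_space_def
proof (intro conjI normed_space_symmetric_ops mcomplete_norm_distI)
  fix X :: "nat \<Rightarrow> 'a complexification \<Rightarrow> 'a complexification"
  assume "\<And>n. X n \<in> \<S>" "\<And>\<epsilon>. \<epsilon> > 0 \<Longrightarrow> \<exists>k. \<forall>m\<ge>k. \<forall>n\<ge>k. opn (X m - X n) < \<epsilon>"
  from symmetric_ops_pointwise_limit[OF this] obtain Z where
    "Z \<in> \<S>" "\<And>\<epsilon>. \<epsilon> > 0 \<Longrightarrow> \<exists>k. \<forall>n\<ge>k. opn (X n - Z) < \<epsilon>" by metis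
  then show "\<exists>Z\<in>\<S>. \<forall>\<epsilon>>0. \<exists>k. \<forall>n\<ge>k. opn (X n - Z) < \<epsilon>" by (intro bexI[of _ Z]) simp_all
qed

section \<open>The Siegel disk as a unit ball\<close>

lemma strictly_positive_iff:
  assumes Z: "Z \<in> \<B>"
  shows "strictly_positive g Lp (\<lambda>x. x - adj Z (Z x)) \<longleftrightarrow>
    (\<exists>c>0. \<forall>x\<in>Lp. (norm_C g (Z x))\<^sup>2 \<le> (1 - c) * (norm_C g x)\<^sup>2)"
proof -
  have right: "sesq_C g x (y - adj Z (Z y)) = sesq_C g x y - sesq_C g (Z x) (Z y)"
    if "x \<in> Lp" "y \<in> Lp" for x y
    using that by (simp add: H_simps sesq_adjoint[OF Z] op_mem[OF Z])
  have left: "sesq_C g (x - adj Z (Z x)) y = sesq_C g x y - sesq_C g (Z x) (Z y)"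
    if "x \<in> Lp" "y \<in> Lp" for x y
    using right[OF that(2,1)] H.hermitian[of y "x - adj Z (Z x)"] H.hermitian[of y x]
      H.hermitian[of "Z y" "Z x"] by simp
  show ?thesis
    unfolding strictly_positive_def
    by (simp add: left right H.nrm_sq left_diff_distrib le_diff_eq add.commute cong: ball_cong)
qed

text \<open>
  Since \<open>g(x, (1 - Z\<^sup>*Z) x) = g(x, x) - g(Z x, Z x)\<close>, strict positivity of \<open>1 - Z\<^sup>*Z\<close> says
  that \<open>Z\<close> shrinks all norms by a common factor below \<open>1\<close>.
\<close>

lemma siegel_disk_eq: "siegel_disk g J = {Z \<in> \<S>. opn Z < 1}"
proof -
  have conj_iff: "Z = conj_C \<circ> adj Z \<circ> conj_C \<longleftrightarrow> conj_C \<circ> Z \<circ> conj_C = adj Z" for Z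
    unfolding fun_eq_iff o_def by (metis conj_C_conj_C)
  have "(\<exists>c>0. \<forall>x\<in>Lp. (norm_C g (Z x))\<^sup>2 \<le> (1 - c) * (norm_C g x)\<^sup>2) \<longleftrightarrow> opn Z < 1"
    if Z: "Z \<in> \<B>" for Z
  proof
    assume "\<exists>c>0. \<forall>x\<in>Lp. (norm_C g (Z x))\<^sup>2 \<le> (1 - c) * (norm_C g x)\<^sup>2"
    then obtain c where c: "c > 0" "\<And>x. x \<in> Lp \<Longrightarrow> (norm_C g (Z x))\<^sup>2 \<le> (1 - c) * (norm_C g x)\<^sup>2"
      by blast
    (* For L^+ = 0 the constant c may exceed 1. *)
    define d where "d = min c 1"
    have d: "0 < d" "d \<le> 1" using c(1) unfolding d_def by auto
    have "opn Z \<le> sqrt (1 - d)"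
    proof (rule op_norm_le)
      show "norm_C g (Z x) \<le> sqrt (1 - d) * norm_C g x" if "x \<in> Lp" for x
      proof (rule power2_le_imp_le)
        have "(1 - c) * (norm_C g x)\<^sup>2 \<le> (1 - d) * (norm_C g x)\<^sup>2"
          unfolding d_def by (intro mult_right_mono) auto
        then show "(norm_C g (Z x))\<^sup>2 \<le> (sqrt (1 - d) * norm_C g x)\<^sup>2"
          using c(2)[OF that] d by (simp add: power_mult_distrib)
        show "0 \<le> sqrt (1 - d) * norm_C g x" using d norm_nonneg by simp
      qed
    qed (use d in simp)
    also have "\<dots> < 1" using d by (simp add: real_sqrt_lt_1_iff)
    finally show "opn Z < 1" .
  next
    assume lt: "opn Z < 1"
    show "\<exists>c>0. \<forall>x\<in>Lp. (norm_C g (Z x))\<^sup>2 \<le> (1 - c) * (norm_C g x)\<^sup>2"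
    proof (intro exI[of _ "1 - (opn Z)\<^sup>2"] conjI ballI)
      show "0 < 1 - (opn Z)\<^sup>2" using lt op_norm_nonneg[OF Z] by (simp add: power_less_one_iff)
      fix x assume "x \<in> Lp"
      then have "(norm_C g (Z x))\<^sup>2 \<le> (opn Z * norm_C g x)\<^sup>2"
        by (intro power_mono norm_le_op_norm[OF Z] norm_nonneg)
      then show "(norm_C g (Z x))\<^sup>2 \<le> (1 - (1 - (opn Z)\<^sup>2)) * (norm_C g x)\<^sup>2"
        by (simp add: power_mult_distrib)
    qed
  qed
  then show ?thesis
    unfolding siegel_disk_def symmetric_ops_eq conj_iff
    using strictly_positive_iff conj_eq_adjoint_iff by blast
qed

lemma op_norm_lipschitz: "Z \<in> \<S> \<Longrightarrow> W \<in> \<S> \<Longrightarrow> opn W \<le> opn Z + opn (W - Z)"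
  using normed_space_triangle[OF normed_space_symmetric_ops, of Z "W - Z"] S_mem(3)[of W Z] by simp

lemma openin_siegel_disk: "openin (norm_topology \<S> opn) (siegel_disk g J)"
  unfolding siegel_disk_eq
  by (rule openin_norm_topology_sublevel[OF normed_space_symmetric_ops]) (rule op_norm_lipschitz)

section \<open>Orthonormal bases\<close>

abbreviation onb where "onb \<equiv> orthonormal_basis_C g Lp"

lemma onbD:
  assumes "onb E"
  shows "E \<subseteq> Lp" "orthonormal_on (sesq_C g) E"
  using assms unfolding orthonormal_basis_C_def orthonormal_on_def by blast+

text \<open>
  Gram-Schmidt applied to the projections to \<open>L\<^sup>+\<close> of a countable dense subset of the whole space.
\<close>

lemma onb_exists: "\<exists>E. onb E"
proof -
  obtain C :: "'a complexification set" where C: "countable C"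
    "\<And>x \<epsilon>. \<epsilon> > 0 \<Longrightarrow> \<exists>q\<in>C. norm_C g (x - q) < \<epsilon>" by (rule countable_dense_C) blast
  have "C \<noteq> {}" using C(2)[of 1 0] by auto
  define d where "d n = proj_plus (from_nat_into C n)" for n
  have d: "d n \<in> Lp" for n unfolding d_def by (rule proj_plus_mem)
  interpret L: carrier_inner_product Lp "sesq_C g"
    by unfold_locales (rule subspace_Lp H.add_left H.scale_left H.hermitian H.positive; simp)+
  let ?P = "\<lambda>F. finite F \<and> F \<subseteq> Lp \<and> orthonormal_on (sesq_C g) F"
  have "\<exists>F. \<forall>n. ?P (F n) \<and> (F n \<subseteq> F (Suc n) \<and> d n \<in> complex_vector.span (F (Suc n)))"
  proof (rule dependent_nat_choice)
    show "\<exists>F. ?P F" by (intro exI[of _ "{}"]) (simp add: orthonormal_on_def)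
    show "\<exists>F'. ?P F' \<and> (F \<subseteq> F' \<and> d n \<in> complex_vector.span F')" if "?P F" for F n
      using that by (metis L.gram_schmidt_step[OF _ _ _ d])
  qed
  then obtain F where F: "\<And>n. F n \<subseteq> Lp" "\<And>n. orthonormal_on (sesq_C g) (F n)"
    "\<And>n. F n \<subseteq> F (Suc n)" "\<And>n. d n \<in> complex_vector.span (F (Suc n))" by blast
  have mono: "F m \<subseteq> F n" if "m \<le> n" for m n using lift_Suc_mono_le[of F, OF F(3) that] .
  define E where "E = (\<Union>n. F n)"
  have "sesq_C g e f = (if e = f then 1 else 0)" if ef: "e \<in> E" "f \<in> E" for e f
  proof -
    obtain m n where "e \<in> F m" "f \<in> F n" using ef unfolding E_def by blast
    then have "e \<in> F (max m n)" "f \<in> F (max m n)"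
      using mono[of m "max m n"] mono[of n "max m n"] by auto
    then show ?thesis using F(2) unfolding orthonormal_on_def by blast
  qed
  moreover have "\<exists>y\<in>complex_vector.span E. norm_C g (x - y) < \<epsilon>" if "x \<in> Lp" "\<epsilon> > 0" for x \<epsilon>
  proof -
    obtain q where q: "q \<in> C" "norm_C g (x - q) < \<epsilon>" using C(2) \<open>\<epsilon> > 0\<close> by blast
    then obtain n where n: "q = from_nat_into C n"
      using C(1) \<open>C \<noteq> {}\<close> by (metis from_nat_into_surj)
    have "x = proj_plus (x - q) + d n"
      using proj_plus_linear(1)[of "x - q" q] proj_plus_id[OF that(1)] by (simp add: d_def n)
    then have "x - d n = proj_plus (x - q)" by (metis add_diff_cancel_right')
    then have "norm_C g (x - d n) < \<epsilon>" using norm_proj_plus[of "x - q"] q(2) by simp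
    moreover have "d n \<in> complex_vector.span E"
      using F(4) complex_vector.span_mono[of "F (Suc n)" E] unfolding E_def by blast
    ultimately show ?thesis by blast
  qed
  moreover have "E \<subseteq> Lp" unfolding E_def using F(1) by blast
  ultimately have "onb E" unfolding orthonormal_basis_C_def by simp
  then show ?thesis by blast
qed

text \<open>Distinct orthonormal vectors have distance \<open>sqrt 2 > 1\<close>, so approximants closer than \<open>1/2\<close> differ.\<close>

lemma countable_orthonormal:
  assumes E: "orthonormal_on (sesq_C g) E"
  shows "countable E"
proof -
  obtain C :: "'a complexification set" where C: "countable C"
    "\<And>x \<epsilon>. \<epsilon> > 0 \<Longrightarrow> \<exists>q\<in>C. norm_C g (x - q) < \<epsilon>" by (rule countable_dense_C) blast
  have "\<exists>q\<in>C. norm_C g (x - q) < 1/2" for x by (rule C(2)) simp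
  then obtain q where q: "\<And>x. q x \<in> C" "\<And>x. norm_C g (x - q x) < 1/2" by metis
  have "inj_on q E"
  proof (rule inj_onI, rule ccontr)
    fix e f assume ef: "e \<in> E" "f \<in> E" "q e = q f" "e \<noteq> f"
    have "norm_C g (e - f) \<le> norm_C g (e - q e) + norm_C g (q f - f)"
      using norm_triangle[of "e - q e" "q f - f"] ef(3) by simp
    also have "\<dots> < 1" using q(2)[of e] q(2)[of f] norm_diff_commute[of f "q f"] by simp
    finally have "norm_C g (e - f) < 1" .
    then have "(norm_C g (e - f))\<^sup>2 < 1" using norm_nonneg[of "e - f"] by (simp add: power_less_one_iff)
    moreover have "Re (sesq_C g (e - f) (e - f)) = 2"
      using E ef unfolding orthonormal_on_def by (simp add: H_simps)
    ultimately show False by (simp add: H.nrm_sq)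
  qed
  moreover have "countable (q ` E)" using C(1) q(1) by (meson countable_subset image_subsetI)
  ultimately show ?thesis by (rule countable_image_inj_on[rotated])
qed

lemma parseval_Lp:
  assumes "onb E" "x \<in> Lp"
  shows "((\<lambda>e. (cmod (sesq_C g x e))\<^sup>2) has_sum (norm_C g x)\<^sup>2) E"
  using assms by (intro H.parseval) (auto simp: orthonormal_basis_C_def orthonormal_on_def)

text \<open>Conjugation turns an orthonormal basis of \<open>L\<^sup>+\<close> into one of \<open>L\<^sup>-\<close>.\<close>

lemma parseval_Lm:
  assumes "onb E" "y \<in> Lm"
  shows "((\<lambda>e. (cmod (sesq_C g y (conj_C e)))\<^sup>2) has_sum (norm_C g y)\<^sup>2) E"
proof -
  have "cmod (sesq_C g (conj_C y) e) = cmod (sesq_C g y (conj_C e))" for e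
    using sesq_conj[of y "conj_C e"] by simp
  then show ?thesis using parseval_Lp[OF assms(1), of "conj_C y"] assms(2) by simp
qed

section \<open>Symmetric Hilbert-Schmidt operators\<close>

text \<open>
  By Parseval the squared entries \<open>\<bar>g(Z e, \<alpha> f)\<bar>\<^sup>2\<close> with \<open>e \<in> E\<close>, \<open>f \<in> F\<close> sum up to \<open>\<parallel>Z e\<parallel>\<^sup>2\<close> along
  \<open>f\<close> and, being symmetric, to \<open>\<parallel>Z f\<parallel>\<^sup>2\<close> along \<open>e\<close>.
\<close>

lemma hs_summable_change_basis:
  assumes Z: "Z \<in> \<S>" and E: "onb E" and F: "onb F"
    and summ: "(\<lambda>e. (norm_C g (Z e))\<^sup>2) summable_on E"
  shows "(\<lambda>e. (norm_C g (Z e))\<^sup>2) summable_on F"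
proof -
  define a where "a = (\<lambda>(e, f). (cmod (sesq_C g (Z e) (conj_C f)))\<^sup>2)"
  have a_sym: "a (e, f) = a (f, e)" if "e \<in> Lp" "f \<in> Lp" for e f
    using S_sym[OF Z] that unfolding symmetric_form_def a_def by simp
  have row: "((\<lambda>f. a (e, f)) has_sum (norm_C g (Z e))\<^sup>2) G" if "e \<in> Lp" "onb G" for e G
    using parseval_Lm[OF that(2) op_mem[OF S_B[OF Z] that(1)]] by (simp add: a_def)
  have "a summable_on E \<times> F"
    using row[OF subsetD[OF onbD(1)[OF E]] F] summ by (rule summable_on_SigmaI) (simp_all add: a_def)
  then have "(\<lambda>(f, e). a (e, f)) summable_on F \<times> E" by (subst (asm) summable_on_swap)
  then have swap: "a summable_on F \<times> E"
    by (rule summable_on_cong[THEN iffD1, rotated]) (use a_sym onbD(1)[OF E] onbD(1)[OF F] in auto)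
  have "(\<lambda>f. infsum (\<lambda>e. a (f, e)) E) summable_on F"
    using row[OF subsetD[OF onbD(1)[OF F]] E]
    by (intro summable_on_SigmaD[OF swap]) (auto simp: summable_on_def)
  moreover have "infsum (\<lambda>e. a (f, e)) E = (norm_C g (Z f))\<^sup>2" if "f \<in> F" for f
    using infsumI[OF row[OF subsetD[OF onbD(1)[OF F] that] E]] .
  ultimately show ?thesis by (simp cong: summable_on_cong)
qed

text \<open>The orthonormal basis in which the Hilbert-Schmidt inner product is evaluated.\<close>

definition basis :: "'a complexification set" where "basis = (SOME E. onb E)"

lemma onb_basis: "onb basis"
  unfolding basis_def using onb_exists by (rule someI_ex)

lemmas basis_Lp = subsetD[OF onbD(1)[OF onb_basis]]

abbreviation \<S>2 where "\<S>2 \<equiv> symmetric_hs_ops g J"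
abbreviation hs where "hs \<equiv> hs_inner_L g J"
abbreviation hsn where "hsn \<equiv> ip_norm hs"

lemma symmetric_hs_ops_iff:
  "Z \<in> \<S>2 \<longleftrightarrow> Z \<in> \<S> \<and> (\<lambda>e. (norm_C g (Z e))\<^sup>2) summable_on basis"
proof -
  have "Z \<in> \<S>2 \<longleftrightarrow> Z \<in> \<S> \<and> (\<exists>E. onb E \<and> (\<lambda>e. (norm_C g (Z e))\<^sup>2) summable_on E)"
    unfolding symmetric_hs_ops_def symmetric_ops_def hilbert_schmidt_ops_def by blast
  then show ?thesis using hs_summable_change_basis[OF _ _ onb_basis] onb_basis by blast
qed

lemma S2_S: "Z \<in> \<S>2 \<Longrightarrow> Z \<in> \<S>"
  and S2_summable: "Z \<in> \<S>2 \<Longrightarrow> (\<lambda>e. (norm_C g (Z e))\<^sup>2) summable_on basis"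
  unfolding symmetric_hs_ops_iff by auto

lemma S2_diff_mem:
  assumes Z: "Z \<in> \<S>2" and W: "W \<in> \<S>2"
  shows "Z - W \<in> \<S>2"
  unfolding symmetric_hs_ops_iff
proof
  show "Z - W \<in> \<S>" by (intro S_mem S2_S Z W)
  have "(\<lambda>e. 2 * (norm_C g (Z e))\<^sup>2 + 2 * (norm_C g (W e))\<^sup>2) summable_on basis"
    by (intro summable_on_add summable_on_cmult_right S2_summable Z W)
  then show "(\<lambda>e. (norm_C g ((Z - W) e))\<^sup>2) summable_on basis"
    by (rule summable_on_comparison_test) (simp_all add: H.nrm_sq_diff_le)
qed

lemma S2_scale_mem: "Z \<in> \<S>2 \<Longrightarrow> c *\<^sub>C Z \<in> \<S>2"
  using S_mem(4)[of Z c] summable_on_cmult_right[of "\<lambda>e. (norm_C g (Z e))\<^sup>2" basis "(cmod c)\<^sup>2"]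
  unfolding symmetric_hs_ops_iff by (simp add: scaleC_fun_def norm_scale power_mult_distrib)

lemma subspace_S2: "complex_vector.subspace \<S>2"
proof -
  have "0 \<in> \<S>2" unfolding symmetric_hs_ops_iff using S_mem(1) by simp
  moreover have "Z + W \<in> \<S>2" if "Z \<in> \<S>2" "W \<in> \<S>2" for Z W
    using S2_diff_mem[OF that(1) S2_diff_mem[OF \<open>0 \<in> \<S>2\<close> that(2)]] by simp
  ultimately show ?thesis using S2_scale_mem unfolding complex_vector.subspace_def by blast
qed

lemma hs_summable:
  assumes Z: "Z \<in> \<S>2" and W: "W \<in> \<S>2"
  shows "(\<lambda>e. sesq_C g (Z e) (W e)) summable_on basis"
proof (rule Infinite_Sum.abs_summable_summable, rule Infinite_Sum.abs_summable_on_comparison_test')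
  show "(\<lambda>e. (norm_C g (Z e))\<^sup>2 + (norm_C g (W e))\<^sup>2) summable_on basis"
    by (intro summable_on_add S2_summable Z W)
  fix e
  show "cmod (sesq_C g (Z e) (W e)) \<le> (norm_C g (Z e))\<^sup>2 + (norm_C g (W e))\<^sup>2"
    using H.cauchy_schwarz[of "Z e" "W e"] sum_squares_bound[of "norm_C g (Z e)" "norm_C g (W e)"]
      mult_nonneg_nonneg[OF norm_nonneg[of "Z e"] norm_nonneg[of "W e"]] by simp
qed

lemma hs_eq: "hs Z W = infsum (\<lambda>e. sesq_C g (Z e) (W e)) basis"
  unfolding hs_inner_L_def hs_inner_def basis_def ..

lemma Re_hs_self: "Z \<in> \<S>2 \<Longrightarrow> Re (hs Z Z) = infsum (\<lambda>e. (norm_C g (Z e))\<^sup>2) basis"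
  unfolding hs_eq using infsum_Re[OF hs_summable[of Z Z]] by (simp add: H.nrm_sq)

lemma hsn_sq: "Z \<in> \<S>2 \<Longrightarrow> (hsn Z)\<^sup>2 = infsum (\<lambda>e. (norm_C g (Z e))\<^sup>2) basis"
  unfolding ip_norm_def[of hs] by (simp add: Re_hs_self infsum_nonneg)

lemma hsn_nonneg: "Z \<in> \<S>2 \<Longrightarrow> 0 \<le> hsn Z"
  unfolding ip_norm_def[of hs] by (simp add: Re_hs_self infsum_nonneg)

text \<open>
  Expanding \<open>Z x\<close> in the conjugate basis and moving \<open>Z\<close> to the basis vectors by symmetry gives
  \<open>\<parallel>Z x\<parallel>\<^sup>2 = \<Sum>e. \<bar>g(Z e, \<alpha> x)\<bar>\<^sup>2\<close>, to which the Cauchy-Schwarz inequality applies termwise.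
\<close>

lemma op_norm_le_hsn:
  assumes Z: "Z \<in> \<S>2"
  shows "opn Z \<le> hsn Z"
proof (rule op_norm_le[OF hsn_nonneg[OF Z]])
  fix x assume x: "x \<in> Lp"
  note ZB = S_B[OF S2_S[OF Z]]
  have "((\<lambda>e. (norm_C g (Z e))\<^sup>2) has_sum (hsn Z)\<^sup>2) basis"
    unfolding hsn_sq[OF Z] by (rule has_sum_infsum[OF S2_summable[OF Z]])
  then have "((\<lambda>e. (norm_C g (Z e))\<^sup>2 * (norm_C g x)\<^sup>2) has_sum (hsn Z)\<^sup>2 * (norm_C g x)\<^sup>2) basis"
    by (rule has_sum_cmult_left)
  moreover have "(cmod (sesq_C g (Z x) (conj_C e)))\<^sup>2 \<le> (norm_C g (Z e))\<^sup>2 * (norm_C g x)\<^sup>2"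
    if "e \<in> basis" for e
  proof -
    have "sesq_C g (Z x) (conj_C e) = sesq_C g (Z e) (conj_C x)"
      using S_sym[OF S2_S[OF Z]] x basis_Lp[OF that] unfolding symmetric_form_def by blast
    then have "cmod (sesq_C g (Z x) (conj_C e)) \<le> norm_C g (Z e) * norm_C g x"
      using H.cauchy_schwarz[of "Z e" "conj_C x"] by simp
    then show ?thesis unfolding power_mult_distrib[symmetric] by (rule power_mono) simp
  qed
  ultimately have "(norm_C g (Z x))\<^sup>2 \<le> (hsn Z)\<^sup>2 * (norm_C g x)\<^sup>2"
    using has_sum_mono[OF parseval_Lm[OF onb_basis op_mem[OF ZB x]]] by blast
  then have "(norm_C g (Z x))\<^sup>2 \<le> (hsn Z * norm_C g x)\<^sup>2" by (simp add: power_mult_distrib)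
  then show "norm_C g (Z x) \<le> hsn Z * norm_C g x"
    by (rule power2_le_imp_le) (simp add: hsn_nonneg[OF Z] norm_nonneg)
qed

sublocale HS: carrier_inner_product \<S>2 hs
proof
  show "complex_vector.subspace \<S>2" by (rule subspace_S2)
  show "hs (x + y) z = hs x z + hs y z" if "x \<in> \<S>2" "y \<in> \<S>2" "z \<in> \<S>2" for x y z
    unfolding hs_eq using infsum_add[OF hs_summable hs_summable, of x z y z] that by (simp add: H_simps)
  show "hs (c *\<^sub>C x) y = c * hs x y" if "x \<in> \<S>2" "y \<in> \<S>2" for c x y
    unfolding hs_eq by (simp add: scaleC_fun_def H_simps infsum_cmult_right')
  show "hs y x = cnj (hs x y)" if "x \<in> \<S>2" "y \<in> \<S>2" for x y
    unfolding hs_eq infsum_cnj[symmetric] by (intro infsum_cong H.hermitian) simp_all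
  show "0 < Re (hs x x)" if x: "x \<in> \<S>2" "x \<noteq> 0" for x
  proof -
    have "opn x \<noteq> 0" "opn x \<ge> 0"
      using x S2_S normed_space_eq_0_iff[OF normed_space_symmetric_ops] op_norm_nonneg[OF S_B] by auto
    then have "hsn x > 0" using op_norm_le_hsn[OF x(1)] by simp
    then show ?thesis unfolding ip_norm_def by simp
  qed
qed

text \<open>
  A Cauchy sequence converges in operator norm, and its tails stay close to the limit because
  every finite partial sum of the Hilbert-Schmidt norm passes to the limit.
\<close>

lemma mcomplete_S2: "Metric_space.mcomplete \<S>2 (norm_dist \<S>2 hsn)"
proof (rule mcomplete_norm_distI[OF HS.normed_space])
  fix X :: "nat \<Rightarrow> 'a complexification \<Rightarrow> 'a complexification"
  assume X: "\<And>n. X n \<in> \<S>2"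
    and cauchy: "\<And>\<epsilon>. \<epsilon> > 0 \<Longrightarrow> \<exists>k. \<forall>m\<ge>k. \<forall>n\<ge>k. hsn (X m - X n) < \<epsilon>"
  have op_cauchy: "\<exists>k. \<forall>m\<ge>k. \<forall>n\<ge>k. opn (X m - X n) < \<epsilon>" if "\<epsilon> > 0" for \<epsilon>
    using cauchy[OF that] op_norm_le_hsn[OF S2_diff_mem[OF X X]] le_less_trans by meson
  obtain Z where Z: "Z \<in> \<S>" and lim: "\<And>x. tends_C (\<lambda>n. X n x) (Z x)"
    using symmetric_ops_pointwise_limit[OF S2_S[OF X] op_cauchy] by metis
  have part: "sum (\<lambda>e. (norm_C g ((X n - Z) e))\<^sup>2) F \<le> \<epsilon>\<^sup>2"
    if k: "\<forall>m\<ge>k. \<forall>n\<ge>k. hsn (X m - X n) < \<epsilon>" and n: "n \<ge> k" and F: "finite F" "F \<subseteq> basis" for n k F \<epsilon>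
  proof (rule LIMSEQ_le_const2)
    show "(\<lambda>m. \<Sum>e\<in>F. (norm_C g (X n e - X m e))\<^sup>2) \<longlonglongrightarrow> (\<Sum>e\<in>F. (norm_C g ((X n - Z) e))\<^sup>2)"
      unfolding minus_apply
      by (intro tendsto_sum tendsto_power tends_C_norm[OF bilinear_g] tends_C_diff tends_C_const lim)
    have "(\<Sum>e\<in>F. (norm_C g (X n e - X m e))\<^sup>2) \<le> \<epsilon>\<^sup>2" if m: "m \<ge> k" for m
    proof -
      have W: "X n - X m \<in> \<S>2" by (intro S2_diff_mem X)
      have "(\<Sum>e\<in>F. (norm_C g ((X n - X m) e))\<^sup>2) \<le> (hsn (X n - X m))\<^sup>2"
        unfolding hsn_sq[OF W] by (rule finite_sum_le_infsum[OF S2_summable[OF W] F]) simp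
      also have "\<dots> \<le> \<epsilon>\<^sup>2" using k n m by (intro power_mono hsn_nonneg W less_imp_le) simp
      finally show ?thesis by simp
    qed
    then show "\<exists>M. \<forall>m\<ge>M. (\<Sum>e\<in>F. (norm_C g (X n e - X m e))\<^sup>2) \<le> \<epsilon>\<^sup>2" by blast
  qed
  have mem: "X n - Z \<in> \<S>2" if k: "\<forall>m\<ge>k. \<forall>n\<ge>k. hsn (X m - X n) < \<epsilon>" and n: "n \<ge> k" for n k \<epsilon>
    unfolding symmetric_hs_ops_iff
  proof
    show "X n - Z \<in> \<S>" by (intro S_mem S2_S X Z)
    show "(\<lambda>e. (norm_C g ((X n - Z) e))\<^sup>2) summable_on basis"
      by (rule nonneg_bdd_above_summable_on) (auto intro!: bdd_aboveI2[of _ _ "\<epsilon>\<^sup>2"] part[OF k n] simp del: fun_diff_def minus_apply)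
  qed
  obtain k where "\<forall>m\<ge>k. \<forall>n\<ge>k. hsn (X m - X n) < 1" using cauchy[of 1] by auto
  then have "X k - (X k - Z) \<in> \<S>2" by (intro S2_diff_mem[OF X] mem) auto
  then have Z2: "Z \<in> \<S>2" by simp
  moreover have "\<exists>k. \<forall>n\<ge>k. hsn (X n - Z) < \<epsilon>" if e: "\<epsilon> > 0" for \<epsilon>
  proof -
    obtain k where k: "\<forall>m\<ge>k. \<forall>n\<ge>k. hsn (X m - X n) < \<epsilon> / 2" using cauchy[of "\<epsilon> / 2"] e by auto
    have "hsn (X n - Z) \<le> \<epsilon> / 2" if n: "n \<ge> k" for n
    proof (rule power2_le_imp_le)
      have W: "X n - Z \<in> \<S>2" by (rule mem[OF k n])
      show "(hsn (X n - Z))\<^sup>2 \<le> (\<epsilon> / 2)\<^sup>2"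
        unfolding hsn_sq[OF W] by (rule infsum_le_finite_sums[OF S2_summable[OF W] part[OF k n]])
    qed (use e in simp)
    then show ?thesis using e by (intro exI[of _ k]) fastforce
  qed
  ultimately show "\<exists>Z\<in>\<S>2. \<forall>\<epsilon>>0. \<exists>k. \<forall>n\<ge>k. hsn (X n - Z) < \<epsilon>" by blast
qed

text \<open>
  Up to \<open>\<epsilon>\<close>, an operator is determined by finitely many basis vectors, outside of which its
  Hilbert-Schmidt norm is small, together with approximate values on them in a countable dense set.
\<close>

lemma separable_S2: "separable_space (norm_topology \<S>2 hsn)"
proof (rule separable_space_norm_topologyI[where 'b="('a complexification \<times> 'a complexification) set",
      OF HS.normed_space])
  fix \<epsilon> :: real assume e: "\<epsilon> > 0"
  (* Each of two operators contributes an error of 2 \<delta> on the chosen basis vectors and 2 \<delta> off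
     them, which makes 8 \<delta> < \<epsilon>\<^sup>2 in total. *)
  define \<delta> where "\<delta> = \<epsilon>\<^sup>2 / 9"
  have \<delta>: "\<delta> > 0" using e by (simp add: \<delta>_def)
  obtain C :: "'a complexification set" where C: "countable C"
    "\<And>x \<epsilon>. \<epsilon> > 0 \<Longrightarrow> \<exists>q\<in>C. norm_C g (x - q) < \<epsilon>" by (rule countable_dense_C) blast
  define approx where "approx Z F q \<longleftrightarrow> finite F \<and> F \<subseteq> basis \<and> q ` F \<subseteq> C \<and>
      infsum (\<lambda>e. (norm_C g (Z e))\<^sup>2) (basis - F) \<le> \<delta> \<and>
      (\<Sum>e\<in>F. (norm_C g (Z e - q e))\<^sup>2) \<le> \<delta>"
    for Z q :: "'a complexification \<Rightarrow> 'a complexification" and F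
  have "\<exists>F q. Z \<in> \<S>2 \<longrightarrow> approx Z F q" for Z
  proof (cases "Z \<in> \<S>2")
    case True
    let ?f = "\<lambda>e. (norm_C g (Z e))\<^sup>2"
    note summ = S2_summable[OF True]
    obtain F where F: "finite F" "F \<subseteq> basis" "dist (sum ?f F) (infsum ?f basis) \<le> \<delta>"
      using infsum_finite_approximation[OF summ \<delta>] by blast
    have "infsum ?f (F \<union> (basis - F)) = infsum ?f F + infsum ?f (basis - F)"
      using F(1) summ by (intro infsum_Un_disjoint) (auto intro: summable_on_subset)
    then have tail: "infsum ?f (basis - F) \<le> \<delta>"
      using F by (simp add: Un_absorb1 dist_real_def)
    define \<rho> where "\<rho> = sqrt (\<delta> / (real (card F) + 1))"
    have \<rho>: "\<rho> > 0" using \<delta> by (simp add: \<rho>_def)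
    have "\<exists>q\<in>C. norm_C g (Z e - q) < \<rho>" for e by (rule C(2)[OF \<rho>])
    then obtain q where q: "\<And>e. q e \<in> C" "\<And>e. norm_C g (Z e - q e) < \<rho>" by metis
    have "(\<Sum>e\<in>F. (norm_C g (Z e - q e))\<^sup>2) \<le> (\<Sum>e\<in>F. \<rho>\<^sup>2)"
      by (intro sum_mono power_mono norm_nonneg less_imp_le q(2))
    also have "\<dots> \<le> \<delta>" using \<delta> by (simp add: \<rho>_def field_simps)
    finally have "approx Z F q" unfolding approx_def using F q(1) tail by auto
    then show ?thesis by blast
  qed simp
  then obtain F q where "\<And>Z. Z \<in> \<S>2 \<Longrightarrow> approx Z (F Z) (q Z)" by metis
  note FQ = this[unfolded approx_def]
  define \<Phi> where "\<Phi> Z = (\<lambda>e. (e, q Z e)) ` F Z" for Z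
  have "\<Phi> ` \<S>2 \<subseteq> {A. finite A \<and> A \<subseteq> basis \<times> C}" unfolding \<Phi>_def using FQ by fastforce
  moreover have "countable {A. finite A \<and> A \<subseteq> basis \<times> C}"
    using C(1) countable_orthonormal[OF onbD(2)[OF onb_basis]]
    by (intro countable_Collect_finite_subset countable_SIGMA) auto
  ultimately have "countable (\<Phi> ` \<S>2)" by (rule countable_subset)
  moreover have "hsn (Z - W) < \<epsilon>" if Z: "Z \<in> \<S>2" and W: "W \<in> \<S>2" and eq: "\<Phi> Z = \<Phi> W" for Z W
  proof -
    have "fst ` \<Phi> Z = F Z" "fst ` \<Phi> W = F W" unfolding \<Phi>_def by force+
    then have F: "F Z = F W" using eq by simp
    have q: "q Z e = q W e" if "e \<in> F W" for e
      using eq that F unfolding \<Phi>_def by (auto simp: set_eq_iff image_iff)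
    let ?f = "\<lambda>e. (norm_C g ((Z - W) e))\<^sup>2"
    have D: "Z - W \<in> \<S>2" by (rule S2_diff_mem[OF Z W])
    note summ = S2_summable[OF D]
    have fin: "finite (F W)" "F W \<subseteq> basis" using FQ W by auto
    have sub: "h summable_on (basis - F W)" if "h summable_on basis" for h :: "_ \<Rightarrow> real"
      using that by (rule summable_on_subset) auto
    have "infsum ?f (F W \<union> (basis - F W)) = infsum ?f (F W) + infsum ?f (basis - F W)"
      using fin summ by (intro infsum_Un_disjoint sub) auto
    then have split: "(hsn (Z - W))\<^sup>2 = sum ?f (F W) + infsum ?f (basis - F W)"
      using fin by (simp add: hsn_sq[OF D] Un_absorb1)
    have "sum ?f (F W) \<le> (\<Sum>e\<in>F W. 2 * (norm_C g (Z e - q W e))\<^sup>2 + 2 * (norm_C g (W e - q W e))\<^sup>2)"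
    proof (rule sum_mono)
      fix e
      show "?f e \<le> 2 * (norm_C g (Z e - q W e))\<^sup>2 + 2 * (norm_C g (W e - q W e))\<^sup>2"
        using H.nrm_sq_diff_le[of "Z e - q W e" "W e - q W e"] by simp
    qed
    also have "\<dots> = 2 * (\<Sum>e\<in>F W. (norm_C g (Z e - q W e))\<^sup>2) + 2 * (\<Sum>e\<in>F W. (norm_C g (W e - q W e))\<^sup>2)"
      by (simp only: sum.distrib sum_distrib_left)
    also have "(\<Sum>e\<in>F W. (norm_C g (Z e - q W e))\<^sup>2) = (\<Sum>e\<in>F Z. (norm_C g (Z e - q Z e))\<^sup>2)"
      by (rule sum.cong) (simp_all add: F q)
    finally have near: "sum ?f (F W) \<le> 4 * \<delta>" using FQ[OF Z] FQ[OF W] by linarith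
    have "infsum ?f (basis - F W) \<le>
        infsum (\<lambda>e. 2 * (norm_C g (Z e))\<^sup>2 + 2 * (norm_C g (W e))\<^sup>2) (basis - F W)"
      by (intro infsum_mono sub summ summable_on_add summable_on_cmult_right S2_summable Z W)
        (simp add: H.nrm_sq_diff_le)
    also have "\<dots> = 2 * infsum (\<lambda>e. (norm_C g (Z e))\<^sup>2) (basis - F W) + 2 * infsum (\<lambda>e. (norm_C g (W e))\<^sup>2) (basis - F W)"
      by (simp add: infsum_add infsum_cmult_right' summable_on_cmult_right sub S2_summable Z W)
    finally have far: "infsum ?f (basis - F W) \<le> 4 * \<delta>"
      using FQ[OF Z, unfolded F] FQ[OF W] by linarith
    have "(hsn (Z - W))\<^sup>2 \<le> 8 * \<delta>" using split near far by linarith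
    also have "\<dots> < \<epsilon>\<^sup>2" using e by (simp add: \<delta>_def)
    finally show ?thesis by (rule power2_less_imp_less) (use e in simp)
  qed
  ultimately show "\<exists>\<Phi> :: _ \<Rightarrow> ('a complexification \<times> 'a complexification) set.
      countable (\<Phi> ` \<S>2) \<and> (\<forall>Z\<in>\<S>2. \<forall>W\<in>\<S>2. \<Phi> Z = \<Phi> W \<longrightarrow> hsn (Z - W) < \<epsilon>)"
    by metis
qed

lemma hilbert_space_S2: "complex_hilbert_space \<S>2 hs"
  by (rule HS.complex_hilbert_spaceI[OF mcomplete_S2 separable_S2])

lemma restricted_siegel_disk_eq: "restricted_siegel_disk g J = {Z \<in> \<S>2. opn Z < 1}"
  unfolding restricted_siegel_disk_def siegel_disk_eq
  by (auto simp: symmetric_hs_ops_def symmetric_ops_def hilbert_schmidt_ops_def)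

lemma openin_restricted_siegel_disk: "openin (norm_topology \<S>2 hsn) (restricted_siegel_disk g J)"
  unfolding restricted_siegel_disk_eq
proof (rule openin_norm_topology_sublevel[OF HS.normed_space])
  fix Z W assume "Z \<in> \<S>2" "W \<in> \<S>2"
  then show "opn W \<le> opn Z + hsn (W - Z)"
    using op_norm_lipschitz[OF S2_S S2_S, of Z W] op_norm_le_hsn[OF S2_diff_mem, of W Z] by simp
qed

end

theorem theorem4p22:
  fixes g \<omega> :: "'a::{real_inner, complete_space} \<Rightarrow> 'a \<Rightarrow> real"
    and J :: "'a \<Rightarrow> 'a"
  assumes "separable_space (euclidean :: 'a topology)"
    and "compatible_triple g J \<omega>"
  defines "S \<equiv> symmetric_ops g J"
    and "S\<^sub>2 \<equiv> symmetric_hs_ops g J"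
    and "N \<equiv> op_norm_L g J"
    and "ip \<equiv> hs_inner_L g J"
    and "D \<equiv> siegel_disk g J"
    and "D\<^sub>2 \<equiv> restricted_siegel_disk g J"
  shows "complex_banach_space S N
    \<and> openin (norm_topology S N) D
    \<and> complex_banach_manifold (subtopology (norm_topology S N) D) {(D, \<lambda>Z. Z)} S N
    \<and> complex_hilbert_space S\<^sub>2 ip
    \<and> openin (norm_topology S\<^sub>2 (ip_norm ip)) D\<^sub>2
    \<and> complex_hilbert_manifold (subtopology (norm_topology S\<^sub>2 (ip_norm ip)) D\<^sub>2) {(D\<^sub>2, \<lambda>Z. Z)} S\<^sub>2 ip"
proof -
  interpret siegel_setting g \<omega> J by unfold_locales (fact assms(1) assms(2))+
  show ?thesis
    unfolding S_def S\<^sub>2_def N_def ip_def D_def D\<^sub>2_def complex_hilbert_manifold_def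
    using banach_space_symmetric_ops openin_siegel_disk hilbert_space_S2 openin_restricted_siegel_disk
      complex_banach_manifold_openin complex_banach_space_of_hilbert by blast
qed

end
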